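(* For each $n\ge 1$ let $U_n$ be an $n\times n$ Haar unitary random matrix, and let $l\ge 1$ be an integer. Then $\operatorname{Tr}U_n,\ \operatorname{Tr}(U_n^2),\ \dots,\ \operatorname{Tr}(U_n^l)$ are asymptotically independent as $n\to\infty$; that is, the $\mathbb{C}^l$-valued random vector $\left(\operatorname{Tr}U_n,\operatorname{Tr}(U_n^2),\dots,\operatorname{Tr}(U_n^l)\right)$ converges in distribution, as $n\to\infty$, to a random vector whose components are independent.
   Context: An $n\times n$ Haar unitary random matrix is a random matrix with values in the group $\mathcal U(n)$ of $n\times n$ complex unitary matrices, distributed according to the normalized Haar measure on $\mathcal U(n)$. $\operatorname{Tr}$ is the usual (unnormalized) trace, and $U_n^i$ is the $i$-th matrix power. *)

theory Defs
  imports
    "HOL-Probability.Probability"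
    "Jordan_Normal_Form.Schur_Decomposition"
begin

text \<open>
  The size \<open>n\<close> tends to infinity, so it cannot be a type: matrices are elements of
  \<^typ>\<open>complex mat\<close> lying in \<^term>\<open>carrier_mat n n\<close>, with indices \<open>0, \<dots>, n - 1\<close>.
\<close>

definition mat_trace :: "complex mat \<Rightarrow> complex" where
  "mat_trace A = (\<Sum>i<dim_row A. A $$ (i, i))"

definition unitary_group :: "nat \<Rightarrow> complex mat set" where
  "unitary_group n =
     {A \<in> carrier_mat n n. A * mat_adjoint A = 1\<^sub>m n \<and> mat_adjoint A * A = 1\<^sub>m n}"

text \<open>
  The type \<^typ>\<open>complex mat\<close> carries no topology. The unitary group gets its usual one, as a
  subspace of the space of \<open>n \<times> n\<close> arrays of complex numbers.
\<close>

definition mat_entries :: "nat \<Rightarrow> complex mat \<Rightarrow> nat \<times> nat \<Rightarrow> complex" where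
  "mat_entries n A = (\<lambda>ij \<in> {..<n} \<times> {..<n}. A $$ ij)"

definition unitary_topology :: "nat \<Rightarrow> complex mat topology" where
  "unitary_topology n =
     pullback_topology (unitary_group n) (mat_entries n)
       (product_topology (\<lambda>_. euclidean) ({..<n} \<times> {..<n}))"

definition unitary_borel :: "nat \<Rightarrow> complex mat measure" where
  "unitary_borel n = sigma (unitary_group n) {S. openin (unitary_topology n) S}"

lemma topspace_unitary_topology [simp]: "topspace (unitary_topology n) = unitary_group n"
  unfolding unitary_topology_def topspace_pullback_topology
  by (auto simp: mat_entries_def)

lemma space_unitary_borel [simp]: "space (unitary_borel n) = unitary_group n"
  unfolding unitary_borel_def
  by (rule space_measure_of) (use openin_subset in fastforce)

lemma sets_unitary_borel:
  "sets (unitary_borel n) = sigma_sets (unitary_group n) {S. openin (unitary_topology n) S}"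
  unfolding unitary_borel_def
  by (rule sets_measure_of) (use openin_subset in fastforce)

text \<open>
  Normalized Haar measure is the Borel probability measure invariant under left translations.
  Regularity is not listed because every finite Borel measure on a compact metrizable space has it.
\<close>

definition unitary_haar :: "nat \<Rightarrow> complex mat measure \<Rightarrow> bool" where
  "unitary_haar n \<mu> \<longleftrightarrow>
     prob_space \<mu> \<and> sets \<mu> = sets (unitary_borel n) \<and>
     (\<forall>V \<in> unitary_group n. \<forall>S \<in> sets (unitary_borel n).
        emeasure \<mu> ((\<lambda>A. V * A) ` S) = emeasure \<mu> S)"

definition haar_unitary_random_matrix ::
    "nat \<Rightarrow> 'a measure \<Rightarrow> ('a \<Rightarrow> complex mat) \<Rightarrow> bool" where
  "haar_unitary_random_matrix n M U \<longleftrightarrow>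
     prob_space M \<and> U \<in> measurable M (unitary_borel n) \<and>
     unitary_haar n (distr M (unitary_borel n) U)"

text \<open>
  Random vectors with components indexed by \<open>I\<close> are maps into \<^term>\<open>I \<rightarrow>\<^sub>E (UNIV :: complex set)\<close>,
  whose product topology is for \<open>I = {1..l}\<close> that of complex \<open>l\<close>-space. Convergence in distribution is
  convergence of expectations of bounded continuous functions; the random vectors may live on
  different probability spaces \<open>M n\<close> and \<open>N\<close>.
\<close>

definition converges_in_distribution ::
    "'i set \<Rightarrow> (nat \<Rightarrow> 'a measure) \<Rightarrow> (nat \<Rightarrow> 'a \<Rightarrow> 'i \<Rightarrow> complex) \<Rightarrow>
     'b measure \<Rightarrow> ('b \<Rightarrow> 'i \<Rightarrow> complex) \<Rightarrow> bool" where
  "converges_in_distribution I M X N Z \<longleftrightarrow>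
     (\<forall>f :: ('i \<Rightarrow> complex) \<Rightarrow> real.
        continuous_map (product_topology (\<lambda>_. euclidean) I) euclideanreal f \<and>
        bounded (f ` (I \<rightarrow>\<^sub>E UNIV)) \<longrightarrow>
        (\<lambda>n. \<integral>\<omega>. f (X n \<omega>) \<partial>M n) \<longlonglongrightarrow> (\<integral>\<omega>. f (Z \<omega>) \<partial>N))"

end

theory Submission
  imports Defs
begin

text \<open>
  Left invariance of Haar measure gives an integration by parts formula on the unitary group. For
  the power traces \<open>p\<^sub>k = Tr U\<^sup>k\<close> and a smooth function \<open>G\<close> it is the loop equation
  \<open>n E[p\<^sub>k G] + \<Sum> E[p\<^sub>m p\<^sub>k\<^sub>-\<^sub>m G] + E[\<Sum> (U\<^sup>k)\<^sub>a\<^sub>b \<partial>\<^sub>a\<^sub>b G] = 0\<close>, the first sum over \<open>0 < m < k\<close>.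
  Taking \<open>G = cnj p\<^sub>k\<close> bounds \<open>E |p\<^sub>k|\<^sup>2\<close> uniformly in \<open>n\<close>, by induction on \<open>k\<close>. Taking
  \<open>G = exp (\<i> s \<Sum> Re (cnj \<xi>\<^sub>j p\<^sub>j))\<close> shows that the characteristic function \<open>\<psi> s = E[G]\<close> satisfies
  \<open>\<psi>' = - (s / 2) (\<Sum> j |\<xi>\<^sub>j|\<^sup>2) \<psi> + O(1/n)\<close>, so it converges to that of independent complex Gaussians
  with variances \<open>E |Z\<^sub>j|\<^sup>2 = j\<close>. The second moment bounds give tightness, and approximation by
  trigonometric polynomials turns this into convergence in distribution.
\<close>

section \<open>Convergence in distribution from characteristic functions\<close>

text \<open>The factor \<open>n\<close> is always the trace of a zeroth power. It arises once when
  the product rule differentiates the first factor of \<open>A^k\<close>, and once when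
  \<open>A^k\<close> meets its own adjoint. Traces of nonzero powers stay bounded in mean square, so
  after division by \<open>n\<close> only the pairing of a power with itself survives. This is why
  the limiting components decouple. The variance \<open>k\<close> counts the factors of
  \<open>A^k\<close> that a derivative can hit. The obstacle is that matrix units are not tangent to
  the unitary group, so no flow in the group differentiates along them. Rank-one Hermitian
  directions suffice: their exponentials are explicit, and by polarization they span all matrices
  over the complex numbers. Only second moments are ever estimated. The approximation by
  trigonometric polynomials is arranged to match: its error grows at most quadratically.\<close>

text \<open>A bounded derivative makes \<open>F\<close> Lipschitz in the parameter, so the
  remainders of the difference quotients are bounded by \<open>2 * B\<close>, an integrable constant
  on a finite measure. Dominated convergence applies along every sequence tending to 0.\<close>

lemma has_vector_derivative_lebesgue_integral:
  fixes F D :: "real \<Rightarrow> 'a \<Rightarrow> complex"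
  assumes "finite_measure M"
    and int: "\<And>t. integrable M (F t)"
    and meas: "D t0 \<in> borel_measurable M"
    and der: "\<And>t \<omega>. \<omega> \<in> space M \<Longrightarrow> ((\<lambda>s. F s \<omega>) has_vector_derivative D t \<omega>) (at t)"
    and bound: "\<And>t \<omega>. \<omega> \<in> space M \<Longrightarrow> norm (D t \<omega>) \<le> B"
  shows "((\<lambda>s. \<integral>\<omega>. F s \<omega> \<partial>M) has_vector_derivative (\<integral>\<omega>. D t0 \<omega> \<partial>M)) (at t0)"
proof -
  interpret finite_measure M by fact
  \<comment> \<open>Normalized remainder of the linear approximation: its pointwise convergence to 0
    is the derivative of \<open>F\<close>, and convergence of its integral is the claim.\<close>
  define Q where "Q h \<omega> = (F (t0 + h) \<omega> - F t0 \<omega> - h *\<^sub>R D t0 \<omega>) /\<^sub>R \<bar>h\<bar>" for h \<omega>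
  have Q_norm: "norm (Q h \<omega>) = norm (F (t0 + h) \<omega> - F t0 \<omega> - h *\<^sub>R D t0 \<omega>) / norm h" for h \<omega>
    unfolding Q_def norm_scaleR by (simp add: divide_inverse_commute)
  have intD: "integrable M (D t0)"
    using bound meas by (intro integrable_const_bound[where B = B]) auto
  have lip: "norm (F s \<omega> - F t \<omega>) \<le> B * norm (s - t)" if "\<omega> \<in> space M" for s t \<omega>
  proof (rule differentiable_bound[where S = UNIV])
    show "((\<lambda>s. F s \<omega>) has_derivative (\<lambda>h. h *\<^sub>R D x \<omega>)) (at x)" for x
      using der[OF that] by (simp add: has_vector_derivative_def)
    show "onorm (\<lambda>h. h *\<^sub>R D x \<omega>) \<le> B" for x
      using bound[OF that, of x] by (intro onorm_le) (simp add: mult.commute[of B] mult_left_mono)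
  qed auto
  have Qb: "norm (Q h \<omega>) \<le> 2 * B" if "\<omega> \<in> space M" "h \<noteq> 0" for h \<omega>
  proof -
    have "norm (F (t0 + h) \<omega> - F t0 \<omega> - h *\<^sub>R D t0 \<omega>) \<le> B * \<bar>h\<bar> + \<bar>h\<bar> * B"
      using lip[OF that(1), of "t0 + h" t0] bound[OF that(1), of t0]
        norm_triangle_ineq4[of "F (t0 + h) \<omega> - F t0 \<omega>" "h *\<^sub>R D t0 \<omega>"]
        mult_left_mono[of "norm (D t0 \<omega>)" B "\<bar>h\<bar>"]
      by (simp add: mult.commute[of B])
    with that(2) show ?thesis
      unfolding Q_norm by (simp add: pos_divide_le_eq)
  qed
  have Qlim: "((\<lambda>h. Q h \<omega>) \<longlongrightarrow> 0) (at 0)" if "\<omega> \<in> space M" for \<omega>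
  proof (rule tendsto_norm_zero_cancel)
    show "((\<lambda>h. norm (Q h \<omega>)) \<longlongrightarrow> 0) (at 0)"
      unfolding Q_norm
      by (rule conjunct2[OF iffD1[OF has_derivative_at der[OF that, unfolded has_vector_derivative_def]]])
  qed
  have "((\<lambda>h. \<integral>\<omega>. Q h \<omega> \<partial>M) \<longlongrightarrow> 0) (at 0)"
    unfolding tendsto_at_iff_sequentially comp_def
  proof (intro allI impI)
    fix X :: "nat \<Rightarrow> real"
    assume X: "\<forall>i. X i \<in> UNIV - {0}" "X \<longlonglongrightarrow> 0"
    have "(\<lambda>i. \<integral>\<omega>. Q (X i) \<omega> \<partial>M) \<longlonglongrightarrow> (\<integral>\<omega>. 0 \<partial>M)"
    proof (rule integral_dominated_convergence[where w = "\<lambda>_. 2 * B"])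
      show "Q (X i) \<in> borel_measurable M" for i
        unfolding Q_def using borel_measurable_integrable[OF int] meas by simp
      show "AE \<omega> in M. (\<lambda>i. Q (X i) \<omega>) \<longlonglongrightarrow> 0"
      proof (rule AE_I2)
        fix \<omega> assume "\<omega> \<in> space M"
        from Qlim[OF this] X show "(\<lambda>i. Q (X i) \<omega>) \<longlonglongrightarrow> 0"
          unfolding tendsto_at_iff_sequentially comp_def by blast
      qed
      show "AE \<omega> in M. norm (Q (X i) \<omega>) \<le> 2 * B" for i
        using Qb X(1) by (intro AE_I2) simp
    qed simp_all
    then show "(\<lambda>i. \<integral>\<omega>. Q (X i) \<omega> \<partial>M) \<longlonglongrightarrow> 0" by simp
  qed
  then have "((\<lambda>h. norm (\<integral>\<omega>. Q h \<omega> \<partial>M)) \<longlongrightarrow> 0) (at 0)"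
    by (rule tendsto_norm_zero)
  moreover have "norm (\<integral>\<omega>. Q h \<omega> \<partial>M) = norm ((\<integral>\<omega>. F (t0 + h) \<omega> \<partial>M) - (\<integral>\<omega>. F t0 \<omega> \<partial>M)
      - h *\<^sub>R (\<integral>\<omega>. D t0 \<omega> \<partial>M)) / norm h" for h
  proof -
    have "(\<integral>\<omega>. Q h \<omega> \<partial>M) = ((\<integral>\<omega>. F (t0 + h) \<omega> \<partial>M) - (\<integral>\<omega>. F t0 \<omega> \<partial>M)
        - h *\<^sub>R (\<integral>\<omega>. D t0 \<omega> \<partial>M)) /\<^sub>R \<bar>h\<bar>"
      unfolding Q_def using int intD by simp
    then show ?thesis by (simp only: norm_scaleR) (simp add: divide_inverse_commute)
  qed
  ultimately have "((\<lambda>h. norm ((\<integral>\<omega>. F (t0 + h) \<omega> \<partial>M) - (\<integral>\<omega>. F t0 \<omega> \<partial>M)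
      - h *\<^sub>R (\<integral>\<omega>. D t0 \<omega> \<partial>M)) / norm h) \<longlongrightarrow> 0) (at 0)"
    by (simp only:)
  then show ?thesis
    unfolding has_vector_derivative_def
    by (intro iffD2[OF has_derivative_at] conjI bounded_linear_scaleR_left)
qed

section \<open>Trigonometric polynomials and their expectations\<close>

text \<open>The complex span of the characters of the real vector space underlying complex
  \<open>I\<close>-space, \<open>Re (cnj z * w)\<close> being the real inner product. An inductive
  definition lets limits of expectations pass from characters to the span; closure under products
  holds because characters multiply to characters.\<close>

inductive trig_poly :: "'i set \<Rightarrow> (('i \<Rightarrow> complex) \<Rightarrow> complex) \<Rightarrow> bool" for I where
  cis: "trig_poly I (\<lambda>x. cis (\<Sum>j\<in>I. Re (cnj (\<xi> j) * x j)))"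
| scale: "trig_poly I f \<Longrightarrow> trig_poly I (\<lambda>x. c * f x)"
| add: "trig_poly I f \<Longrightarrow> trig_poly I g \<Longrightarrow> trig_poly I (\<lambda>x. f x + g x)"

lemma trig_poly_const: "trig_poly I (\<lambda>_. c)"
  using trig_poly.scale[OF trig_poly.cis[of I "\<lambda>_. 0"], of c] by simp

lemma trig_poly_cis_mult:
  assumes "trig_poly I f"
  shows "trig_poly I (\<lambda>x. cis (\<Sum>j\<in>I. Re (cnj (\<xi> j) * x j)) * f x)"
  using assms
proof induction
  case (cis \<zeta>)
  have "(\<lambda>x. cis (\<Sum>j\<in>I. Re (cnj (\<xi> j) * x j)) * cis (\<Sum>j\<in>I. Re (cnj (\<zeta> j) * x j)))
      = (\<lambda>x. cis (\<Sum>j\<in>I. Re (cnj (\<xi> j + \<zeta> j) * x j)))"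
    by (simp add: cis_mult sum.distrib distrib_right add_ac)
  then show ?case by (simp only: trig_poly.cis)
next
  case (scale f c)
  from trig_poly.scale[OF this(2), of c] show ?case by (simp add: mult.left_commute)
next
  case (add f g)
  from trig_poly.add[OF this(3,4)] show ?case by (simp add: ring_distribs)
qed

lemma trig_poly_mult:
  assumes "trig_poly I f" "trig_poly I g"
  shows "trig_poly I (\<lambda>x. f x * g x)"
  using assms(1)
proof induction
  case (cis \<zeta>)
  show ?case by (rule trig_poly_cis_mult) fact
next
  case (scale f c)
  from trig_poly.scale[OF this(2), of c] show ?case by (simp add: mult.assoc)
next
  case (add f g)
  from trig_poly.add[OF this(3,4)] show ?case by (simp add: ring_distribs)
qed

text \<open>The frequency is supported at the single coordinate \<open>i\<close>, and Euler's
  formula combines it with its negative. A real \<open>\<zeta>\<close> reads off the real part of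
  the coordinate, an imaginary one the imaginary part.\<close>

lemma trig_poly_sin:
  assumes "finite I" "i \<in> I"
  shows "trig_poly I (\<lambda>x. complex_of_real (sin (Re (cnj \<zeta> * x i))))"
proof -
  have *: "trig_poly I (\<lambda>x. cis (Re (cnj \<eta> * x i)))" for \<eta>
  proof -
    have "Re (cnj (if j = i then \<eta> else 0) * z) = (if j = i then Re (cnj \<eta> * z) else 0)" for j z
      by simp
    then have "(\<Sum>j\<in>I. Re (cnj (if j = i then \<eta> else 0) * x j)) = Re (cnj \<eta> * x i)" for x :: "'a \<Rightarrow> complex"
      using assms by (simp only: sum.delta) simp
    with trig_poly.cis[of I "\<lambda>j. if j = i then \<eta> else 0"] show ?thesis
      by simp
  qed
  have "complex_of_real (sin y) = (- \<i> / 2) * cis y + (\<i> / 2) * cis (- y)" for y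
    by (simp add: complex_eq_iff)
  then have "(\<lambda>x. complex_of_real (sin (Re (cnj \<zeta> * x i)))) =
      (\<lambda>x. (- \<i> / 2) * cis (Re (cnj \<zeta> * x i)) + (\<i> / 2) * cis (Re (cnj (- \<zeta>) * x i)))"
    by simp
  moreover have "trig_poly I (\<lambda>x. (- \<i> / 2) * cis (Re (cnj \<zeta> * x i)) + (\<i> / 2) * cis (Re (cnj (- \<zeta>) * x i)))"
    by (intro trig_poly.add trig_poly.scale *)
  ultimately show ?thesis by (simp only:)
qed

lemma trig_poly_measurable:
  assumes "trig_poly I h" "\<And>i. i \<in> I \<Longrightarrow> (\<lambda>\<omega>. X \<omega> i) \<in> borel_measurable M"
  shows "(\<lambda>\<omega>. h (X \<omega>)) \<in> borel_measurable M"
  using assms(1)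
proof induction
  case (cis \<zeta>)
  have "(\<lambda>\<omega>. \<Sum>j\<in>I. Re (cnj (\<zeta> j) * X \<omega> j)) \<in> borel_measurable M"
    using assms(2) by (intro borel_measurable_sum) (measurable, auto)
  then show ?case
    by (rule measurable_compose) (intro borel_measurable_continuous_onI continuous_intros)
qed auto

lemma trig_poly_bounded:
  assumes "trig_poly I h"
  obtains B where "\<And>x. norm (h x) \<le> B"
proof -
  from assms have "\<exists>B. \<forall>x. norm (h x) \<le> B"
  proof induction
    case (scale f c)
    then obtain B where "norm (f x) \<le> B" for x by auto
    then have "norm (c * f x) \<le> norm c * B" for x by (simp add: norm_mult mult_left_mono)
    then show ?case by auto
  next
    case (add f g)
    then obtain B C where "norm (f x) \<le> B" "norm (g x) \<le> C" for x by auto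
    then have "norm (f x + g x) \<le> B + C" for x by (meson norm_triangle_le add_mono)
    then show ?case by auto
  qed auto
  then show ?thesis using that by blast
qed

lemma trig_poly_integrable:
  assumes "trig_poly I h" "\<And>i. i \<in> I \<Longrightarrow> (\<lambda>\<omega>. X \<omega> i) \<in> borel_measurable M" "prob_space M"
  shows "integrable M (\<lambda>\<omega>. h (X \<omega>))"
proof -
  interpret prob_space M by fact
  obtain B where "\<And>x. norm (h x) \<le> B" using trig_poly_bounded[OF assms(1)] by blast
  then show ?thesis
    using trig_poly_measurable[OF assms(1,2)] by (intro integrable_const_bound[where B = B]) auto
qed

lemma trig_poly_expectation_tendsto:
  assumes M: "\<And>n. n \<ge> 1 \<Longrightarrow> prob_space (M n)"
    and X: "\<And>n i. n \<ge> 1 \<Longrightarrow> i \<in> I \<Longrightarrow> (\<lambda>\<omega>. X n \<omega> i) \<in> borel_measurable (M n)"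
    and N: "prob_space N"
    and Z: "\<And>i. i \<in> I \<Longrightarrow> (\<lambda>\<omega>. Z \<omega> i) \<in> borel_measurable N"
    and conv: "\<And>\<xi>. (\<lambda>n. \<integral>\<omega>. cis (\<Sum>j\<in>I. Re (cnj (\<xi> j) * X n \<omega> j)) \<partial>M n)
       \<longlonglongrightarrow> (\<integral>\<omega>. cis (\<Sum>j\<in>I. Re (cnj (\<xi> j) * Z \<omega> j)) \<partial>N)"
    and h: "trig_poly I h"
  shows "(\<lambda>n. \<integral>\<omega>. h (X n \<omega>) \<partial>M n) \<longlonglongrightarrow> (\<integral>\<omega>. h (Z \<omega>) \<partial>N)"
  using h
proof induction
  case (cis \<zeta>)
  show ?case by (rule conv)
next
  case (scale f c)
  from tendsto_mult_left[OF this(2), of c] show ?case by simp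
next
  case (add f g)
  have "eventually (\<lambda>n. (\<integral>\<omega>. f (X n \<omega>) \<partial>M n) + (\<integral>\<omega>. g (X n \<omega>) \<partial>M n)
      = (\<integral>\<omega>. f (X n \<omega>) + g (X n \<omega>) \<partial>M n)) sequentially"
    using eventually_ge_at_top[of 1]
    by eventually_elim (use add.hyps X M in \<open>simp add: trig_poly_integrable\<close>)
  moreover have "(\<integral>\<omega>. f (Z \<omega>) \<partial>N) + (\<integral>\<omega>. g (Z \<omega>) \<partial>N) = (\<integral>\<omega>. f (Z \<omega>) + g (Z \<omega>) \<partial>N)"
    using add.hyps Z N by (simp add: trig_poly_integrable)
  ultimately show ?case
    using tendsto_add[OF add.IH] by (auto intro: Lim_transform_eventually)
qed

section \<open>Approximation of bounded continuous functions\<close>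

text \<open>Passes from the topology on extensional functions to the whole function type, where
  compactness, Stone-Weierstrass and Borel measurability are used. Restriction to \<open>I\<close>
  is a continuous retraction.\<close>

lemma continuous_on_restrict_coordinates:
  fixes f :: "('i \<Rightarrow> complex) \<Rightarrow> real"
  assumes "continuous_map (product_topology (\<lambda>_. euclidean) I) euclideanreal f"
  shows "continuous_on UNIV (\<lambda>x. f (restrict x I))"
proof -
  have "continuous_map (product_topology (\<lambda>_. euclidean) UNIV) (product_topology (\<lambda>_. euclidean) I)
      (\<lambda>x. restrict x I)"
    by (intro continuous_map_coordinatewise_then_product) (auto intro: continuous_map_product_projection)
  from continuous_map_compose[OF this assms] show ?thesis
    by (simp add: euclidean_product_topology comp_def)
qed

text \<open>On the cube \<open>|Re x\<^sub>i|, |Im x\<^sub>i| \<le> L\<close> the coordinates are functions of \<open>sin (Re x\<^sub>i / L)\<close> and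
  \<open>sin (Im x\<^sub>i / L)\<close>, and polynomials in these sines are trigonometric polynomials. So Stone-Weierstrass
  gives an approximation that is also bounded outside the cube.\<close>

lemma trig_poly_approx:
  fixes f :: "('i::countable \<Rightarrow> complex) \<Rightarrow> real"
  assumes I: "finite I" and lam: "L > (0::real)" and e: "\<epsilon> > 0"
    and f: "continuous_map (product_topology (\<lambda>_. euclidean) I) euclideanreal f"
    and B: "\<And>x. x \<in> I \<rightarrow>\<^sub>E UNIV \<Longrightarrow> \<bar>f x\<bar> \<le> B"
  obtains h where "trig_poly I h"
    "\<And>x. x \<in> I \<rightarrow>\<^sub>E UNIV \<Longrightarrow> norm (complex_of_real (f x) - h x) \<le> \<epsilon> + 2 * B / L\<^sup>2 * (\<Sum>i\<in>I. (norm (x i))\<^sup>2)"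
proof -
  define S where "S = (PiE I (\<lambda>_. cbox (- 1 - \<i>) (1 + \<i>)))"
  define s :: "('i \<Rightarrow> complex) \<Rightarrow> 'i \<Rightarrow> complex"
    where "s x = (\<lambda>i\<in>I. Complex (sin (Re (x i) / L)) (sin (Im (x i) / L)))" for x
  define r :: "('i \<Rightarrow> complex) \<Rightarrow> 'i \<Rightarrow> complex"
    where "r y = (\<lambda>i\<in>I. Complex (L * arcsin (Re (y i))) (L * arcsin (Im (y i))))" for y
  \<comment> \<open>Real functions on the cube whose pullback along \<open>s\<close> is a
    trigonometric polynomial. Stone-Weierstrass is applied to this ring on the compact image side,
    so the approximation error is controlled at \<open>s x\<close> for every
    \<open>x\<close>.\<close>
  define R where "R = {q. continuous_on S q \<and> trig_poly I (\<lambda>x. complex_of_real (q (s x)))}"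
  have S_iff: "z \<in> cbox (- 1 - \<i>) (1 + \<i>) \<longleftrightarrow> \<bar>Re z\<bar> \<le> 1 \<and> \<bar>Im z\<bar> \<le> 1" for z
    by (auto simp: in_cbox_complex_iff)
  note f_cont = continuous_on_restrict_coordinates[OF f]
  have s_S: "s x \<in> S" for x
    by (auto simp: s_def S_def S_iff)
  have r_PiE: "r y \<in> I \<rightarrow>\<^sub>E UNIV" for y by (auto simp: r_def)
  have coord_cont: "continuous_on S (\<lambda>x. x i)" for i
    by (rule continuous_on_subset[OF continuous_on_product_coordinates]) simp
  interpret R: function_ring_on R S
  proof
    \<comment> \<open>Off \<open>I\<close> an extensional function has the single value
      \<open>undefined\<close>, so \<open>S\<close> is a product of compact sets over all
      indices.\<close>
    have "S = PiE UNIV (\<lambda>i. if i \<in> I then cbox (- 1 - \<i>) (1 + \<i>) else {undefined})"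
      by (auto simp: S_def PiE_iff extensional_def split: if_splits)
    then have "compactin (product_topology (\<lambda>_. euclidean) UNIV) S"
      by (simp add: compactin_PiE)
    then show "compact S"
      by (simp add: euclidean_product_topology)
  next
    fix q assume "q \<in> R" then show "continuous_on S q" by (simp add: R_def)
  next
    fix p q assume "p \<in> R" "q \<in> R"
    then show "(\<lambda>x. p x + q x) \<in> R" "(\<lambda>x. p x * q x) \<in> R"
      by (auto simp: R_def intro!: continuous_intros trig_poly.add trig_poly_mult)
  next
    show "(\<lambda>_. c) \<in> R" for c by (auto simp: R_def trig_poly_const)
  next
    fix x y assume "x \<in> S" "y \<in> S" "x \<noteq> y"
    then obtain i where i: "i \<in> I" "x i \<noteq> y i" unfolding S_def by (meson PiE_ext)
    have "trig_poly I (\<lambda>x. complex_of_real (sin (Re (x i) / L)))"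
      using trig_poly_sin[OF I i(1), of "complex_of_real (1 / L)"] by simp
    then have 1: "(\<lambda>x. Re (x i)) \<in> R"
      using i by (auto simp: R_def s_def intro!: continuous_intros coord_cont)
    have "trig_poly I (\<lambda>x. complex_of_real (sin (Im (x i) / L)))"
      using trig_poly_sin[OF I i(1), of "\<i> * complex_of_real (1 / L)"] by simp
    then have 2: "(\<lambda>x. Im (x i)) \<in> R"
      using i by (auto simp: R_def s_def intro!: continuous_intros coord_cont)
    show "\<exists>f\<in>R. f x \<noteq> f y"
      using i(2) bexI[OF _ 1, of "\<lambda>f. f x \<noteq> f y"] bexI[OF _ 2, of "\<lambda>f. f x \<noteq> f y"]
      unfolding complex_eq_iff by blast
  qed
  have r_cont: "continuous_on S r"
  proof (intro continuous_on_coordinatewise_then_product)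
    fix i
    show "continuous_on S (\<lambda>y. r y i)"
    proof (cases "i \<in> I")
      case True
      then show ?thesis unfolding r_def Complex_eq
        by (auto intro!: continuous_intros coord_cont) (auto simp: S_def S_iff PiE_iff abs_le_iff)
    qed (simp add: r_def)
  qed
  have "continuous_on S (\<lambda>y. f (restrict (r y) I))"
    using continuous_on_compose[OF r_cont continuous_on_subset[OF f_cont]] by (simp add: comp_def)
  moreover have "restrict (r y) I = r y" for y by (simp add: r_def)
  ultimately have "continuous_on S (\<lambda>y. f (r y))" by simp
  from R.Stone_Weierstrass_basic[OF this e]
  obtain q where q: "q \<in> R" "\<And>y. y \<in> S \<Longrightarrow> \<bar>f (r y) - q y\<bar> < \<epsilon>"
    by blast
  show ?thesis
  proof (rule that)
    show "trig_poly I (\<lambda>x. complex_of_real (q (s x)))"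
      using q by (simp add: R_def)
    fix x :: "'i \<Rightarrow> complex" assume x: "x \<in> I \<rightarrow>\<^sub>E UNIV"
    have B0: "B \<ge> 0" using B[OF x] by linarith
    \<comment> \<open>If all coordinates have norm at most \<open>L\<close>, then \<open>r\<close>
      inverts \<open>s\<close> at \<open>x\<close> and the left side is 0. Otherwise one coordinate
      alone makes the right side at least \<open>2 * B\<close>, the trivial bound.\<close>
    have "\<bar>f x - f (r (s x))\<bar> \<le> 2 * B / L\<^sup>2 * (\<Sum>i\<in>I. (norm (x i))\<^sup>2)"
    proof (cases "\<forall>i\<in>I. norm (x i) \<le> L")
      case True
      have arcsin_sin_scaled: "arcsin (sin (u / L)) = u / L" if "\<bar>u\<bar> \<le> L" for u
      proof -
        have "\<bar>u / L\<bar> \<le> 1" using that lam by simp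
        then have "- (pi / 2) \<le> u / L" "u / L \<le> pi / 2" using pi_gt3 by linarith+
        then show ?thesis by (simp add: arcsin_sin)
      qed
      have "r (s x) i = x i" if "i \<in> I" for i
      proof -
        have "norm (x i) \<le> L" using True that by simp
        then have "\<bar>Re (x i)\<bar> \<le> L" "\<bar>Im (x i)\<bar> \<le> L"
          using abs_Re_le_cmod[of "x i"] abs_Im_le_cmod[of "x i"] by linarith+
        then show ?thesis
          using that lam by (simp add: r_def s_def arcsin_sin_scaled)
      qed
      then have "r (s x) = x" by (rule PiE_ext[OF r_PiE x])
      then show ?thesis using B0 by (simp add: sum_nonneg)
    next
      case False
      then obtain i where i: "i \<in> I" "norm (x i) > L" by auto
      have "L\<^sup>2 \<le> (norm (x i))\<^sup>2" using i lam by (intro power_mono) auto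
      also have "\<dots> \<le> (\<Sum>i\<in>I. (norm (x i))\<^sup>2)" using i I by (intro member_le_sum) auto
      finally have "2 * B * 1 \<le> 2 * B * ((\<Sum>i\<in>I. (norm (x i))\<^sup>2) / L\<^sup>2)"
        using B0 lam by (intro mult_left_mono) auto
      moreover have "\<bar>f x - f (r (s x))\<bar> \<le> 2 * B"
        using B[OF x] B[OF r_PiE[of "s x"]] by linarith
      ultimately show ?thesis by (simp add: field_simps)
    qed
    moreover have "\<bar>f (r (s x)) - q (s x)\<bar> < \<epsilon>" using q(2) s_S by blast
    ultimately have "\<bar>f x - q (s x)\<bar> \<le> \<epsilon> + 2 * B / L\<^sup>2 * (\<Sum>i\<in>I. (norm (x i))\<^sup>2)"
      by linarith
    then show "norm (complex_of_real (f x) - complex_of_real (q (s x)))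
        \<le> \<epsilon> + 2 * B / L\<^sup>2 * (\<Sum>i\<in>I. (norm (x i))\<^sup>2)"
      by (simp only: norm_of_real flip: of_real_diff)
  qed
qed

text \<open>The pointwise error grows quadratically, so integrating it costs only second moments.
  For a countable index type, measurability into the function space can be checked
  coordinatewise.\<close>

lemma expectation_approx:
  fixes f :: "('i::countable \<Rightarrow> complex) \<Rightarrow> real" and X :: "'a \<Rightarrow> 'i \<Rightarrow> complex" and C D \<epsilon> :: real
  assumes M: "prob_space M" and I: "finite I"
    and X: "\<And>i. i \<in> I \<Longrightarrow> (\<lambda>\<omega>. X \<omega> i) \<in> borel_measurable M" "\<And>\<omega>. X \<omega> \<in> I \<rightarrow>\<^sub>E UNIV"
    and X2: "\<And>i. i \<in> I \<Longrightarrow> integrable M (\<lambda>\<omega>. (norm (X \<omega> i))\<^sup>2)"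
      "\<And>i. i \<in> I \<Longrightarrow> (\<integral>\<omega>. (norm (X \<omega> i))\<^sup>2 \<partial>M) \<le> C"
    and f: "continuous_map (product_topology (\<lambda>_. euclidean) I) euclideanreal f"
    and B: "\<And>x. x \<in> I \<rightarrow>\<^sub>E UNIV \<Longrightarrow> \<bar>f x\<bar> \<le> B"
    and h: "trig_poly I h" and D: "D \<ge> 0"
    and fh: "\<And>x. x \<in> I \<rightarrow>\<^sub>E UNIV \<Longrightarrow> norm (complex_of_real (f x) - h x) \<le> \<epsilon> + D * (\<Sum>i\<in>I. (norm (x i))\<^sup>2)"
  shows "norm (complex_of_real (\<integral>\<omega>. f (X \<omega>) \<partial>M) - (\<integral>\<omega>. h (X \<omega>) \<partial>M)) \<le> \<epsilon> + D * (card I * C)"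
proof -
  interpret prob_space M by fact
  have "(\<lambda>\<omega>. X \<omega>) \<in> borel_measurable M"
  proof (rule measurable_coordinatewise_then_product)
    show "(\<lambda>\<omega>. X \<omega> i) \<in> borel_measurable M" for i
    proof (cases "i \<in> I")
      case False
      then have "(\<lambda>\<omega>. X \<omega> i) = (\<lambda>_. undefined)" using X(2) by (auto simp: PiE_iff extensional_def)
      then show ?thesis by simp
    qed (rule X)
  qed
  then have "(\<lambda>\<omega>. f (restrict (X \<omega>) I)) \<in> borel_measurable M"
    by (rule measurable_compose[OF _ borel_measurable_continuous_onI[OF continuous_on_restrict_coordinates[OF f]]])
  moreover have "restrict (X \<omega>) I = X \<omega>" for \<omega> using X(2) by (auto simp: PiE_iff extensional_restrict)
  ultimately have "(\<lambda>\<omega>. f (X \<omega>)) \<in> borel_measurable M" by simp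
  then have fi: "integrable M (\<lambda>\<omega>. f (X \<omega>))"
    using B X(2) by (intro integrable_const_bound[where B = B]) auto
  have hi: "integrable M (\<lambda>\<omega>. h (X \<omega>))"
    by (rule trig_poly_integrable[OF h X(1) M])
  have "norm (complex_of_real (\<integral>\<omega>. f (X \<omega>) \<partial>M) - (\<integral>\<omega>. h (X \<omega>) \<partial>M))
      = norm (\<integral>\<omega>. complex_of_real (f (X \<omega>)) - h (X \<omega>) \<partial>M)"
    using fi hi by simp
  also have "\<dots> \<le> (\<integral>\<omega>. norm (complex_of_real (f (X \<omega>)) - h (X \<omega>)) \<partial>M)"
    by (rule integral_norm_bound)
  also have "\<dots> \<le> (\<integral>\<omega>. \<epsilon> + D * (\<Sum>i\<in>I. (norm (X \<omega> i))\<^sup>2) \<partial>M)"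
    using fi hi X2 X(2) fh
    by (intro integral_mono integrable_norm Bochner_Integration.integrable_diff integrable_of_real
          Bochner_Integration.integrable_add integrable_const integrable_mult_right
          Bochner_Integration.integrable_sum) auto
  also have "\<dots> = \<epsilon> + D * (\<Sum>i\<in>I. (\<integral>\<omega>. (norm (X \<omega> i))\<^sup>2 \<partial>M))"
    using X2 by (simp add: prob_space)
  also have "\<dots> \<le> \<epsilon> + D * (card I * C)"
    using X2(2) by (intro add_left_mono mult_left_mono D sum_bounded_above) auto
  finally show ?thesis .
qed

text \<open>The approximant \<open>h\<close> has to be fixed before \<open>n\<close>. The uniform
  second moment bound lets one \<open>h\<close> serve every \<open>X n\<close> and also
  \<open>Z\<close>; what remains is convergence of the expectation of \<open>h\<close>, a finite
  combination of characters.\<close>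

lemma converges_in_distribution_of_characteristic_functions:
  fixes X :: "nat \<Rightarrow> 'a \<Rightarrow> 'i::countable \<Rightarrow> complex" and Z :: "'b \<Rightarrow> 'i \<Rightarrow> complex" and C :: real
  assumes I: "finite I"
    and M: "\<And>n. n \<ge> 1 \<Longrightarrow> prob_space (M n)"
    and X: "\<And>n i. n \<ge> 1 \<Longrightarrow> i \<in> I \<Longrightarrow> (\<lambda>\<omega>. X n \<omega> i) \<in> borel_measurable (M n)" "\<And>n \<omega>. X n \<omega> \<in> I \<rightarrow>\<^sub>E UNIV"
    and X2: "\<And>n i. n \<ge> 1 \<Longrightarrow> i \<in> I \<Longrightarrow> integrable (M n) (\<lambda>\<omega>. (norm (X n \<omega> i))\<^sup>2)"
      "\<And>n i. n \<ge> 1 \<Longrightarrow> i \<in> I \<Longrightarrow> (\<integral>\<omega>. (norm (X n \<omega> i))\<^sup>2 \<partial>M n) \<le> C"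
    and N: "prob_space N"
    and Z: "\<And>i. i \<in> I \<Longrightarrow> (\<lambda>\<omega>. Z \<omega> i) \<in> borel_measurable N" "\<And>\<omega>. Z \<omega> \<in> I \<rightarrow>\<^sub>E UNIV"
    and Z2: "\<And>i. i \<in> I \<Longrightarrow> integrable N (\<lambda>\<omega>. (norm (Z \<omega> i))\<^sup>2)"
    and conv: "\<And>\<xi>. (\<lambda>n. \<integral>\<omega>. cis (\<Sum>j\<in>I. Re (cnj (\<xi> j) * X n \<omega> j)) \<partial>M n)
       \<longlonglongrightarrow> (\<integral>\<omega>. cis (\<Sum>j\<in>I. Re (cnj (\<xi> j) * Z \<omega> j)) \<partial>N)"
  shows "converges_in_distribution I M X N Z"
  unfolding converges_in_distribution_def
proof (intro allI impI, elim conjE)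
  fix f :: "('i \<Rightarrow> complex) \<Rightarrow> real"
  assume f: "continuous_map (product_topology (\<lambda>_. euclidean) I) euclideanreal f"
    and "bounded (f ` (I \<rightarrow>\<^sub>E UNIV))"
  then obtain B where B: "\<And>x. x \<in> I \<rightarrow>\<^sub>E UNIV \<Longrightarrow> \<bar>f x\<bar> \<le> B"
    by (auto simp: bounded_iff)
  \<comment> \<open>Any point of the extensional function space would do; it is needed only for
    \<open>B\<close> to be nonnegative.\<close>
  then have "\<bar>f (X 0 undefined)\<bar> \<le> B" using X(2) by blast
  then have B0: "B \<ge> 0" by linarith
  \<comment> \<open>One constant dominating the second moments of both the sequence and the limit,
    and 0 as well.\<close>
  define C' where "C' = max (max C 0) (\<Sum>i\<in>I. (\<integral>\<omega>. (norm (Z \<omega> i))\<^sup>2 \<partial>N))"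
  have C': "C' \<ge> C" "C' \<ge> 0" by (auto simp: C'_def)
  have CZ: "(\<integral>\<omega>. (norm (Z \<omega> i))\<^sup>2 \<partial>N) \<le> C'" if "i \<in> I" for i
    unfolding C'_def
    by (rule max.coboundedI2, rule member_le_sum[of i I "\<lambda>i. \<integral>\<omega>. (norm (Z \<omega> i))\<^sup>2 \<partial>N"]) (use that I in auto)
  have "(\<lambda>n. complex_of_real (\<integral>\<omega>. f (X n \<omega>) \<partial>M n)) \<longlonglongrightarrow> complex_of_real (\<integral>\<omega>. f (Z \<omega>) \<partial>N)"
  proof (rule tendstoI)
    fix e :: real assume e: "e > 0"
    \<comment> \<open>Chosen so that the quadratic error integrates to at most \<open>e / 6\<close>;
      with the uniform error \<open>e / 6\<close> this gives \<open>e / 3\<close> on either side.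
      The summand 1 keeps \<open>L\<close> positive when the root vanishes.\<close>
    define L where "L = 1 + sqrt (2 * B * (card I * C') / (e / 6))"
    have L: "L > 0" "L\<^sup>2 \<ge> 2 * B * (card I * C') / (e / 6)"
    proof -
      let ?a = "2 * B * (card I * C') / (e / 6)"
      have a: "?a \<ge> 0" using B0 C' e by simp
      then have "sqrt ?a \<ge> 0" by simp
      then show "L > 0" unfolding L_def by linarith
      have "?a = (sqrt ?a)\<^sup>2" using a by simp
      also have "\<dots> \<le> L\<^sup>2" unfolding L_def using \<open>sqrt ?a \<ge> 0\<close> by (intro power_mono) auto
      finally show "L\<^sup>2 \<ge> ?a" .
    qed
    have D: "2 * B / L\<^sup>2 * (card I * C') \<le> e / 6"
      using L e by (simp add: field_simps)
    obtain h where h: "trig_poly I h" and fh: "\<And>x. x \<in> I \<rightarrow>\<^sub>E UNIV \<Longrightarrow>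
        norm (complex_of_real (f x) - h x) \<le> e / 6 + 2 * B / L\<^sup>2 * (\<Sum>i\<in>I. (norm (x i))\<^sup>2)"
      using trig_poly_approx[OF I L(1) _ f B, of "e / 6"] e by auto
    have D0: "2 * B / L\<^sup>2 \<ge> 0" using B0 by simp
    have 1: "norm (complex_of_real (\<integral>\<omega>. f (X n \<omega>) \<partial>M n) - (\<integral>\<omega>. h (X n \<omega>) \<partial>M n)) \<le> e / 3" if "n \<ge> 1" for n
      using expectation_approx[OF M[OF that] I X(1)[OF that] X(2) X2(1)[OF that]
          order_trans[OF X2(2)[OF that] C'(1)] f B h D0 fh] D by simp
    have 2: "norm (complex_of_real (\<integral>\<omega>. f (Z \<omega>) \<partial>N) - (\<integral>\<omega>. h (Z \<omega>) \<partial>N)) \<le> e / 3"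
      using expectation_approx[OF N I Z Z2 CZ f B h D0 fh] D by simp
    have "(\<lambda>n. \<integral>\<omega>. h (X n \<omega>) \<partial>M n) \<longlonglongrightarrow> (\<integral>\<omega>. h (Z \<omega>) \<partial>N)"
      by (rule trig_poly_expectation_tendsto[OF M X(1) N Z(1) conv h])
    then have "\<forall>\<^sub>F n in sequentially. dist (\<integral>\<omega>. h (X n \<omega>) \<partial>M n) (\<integral>\<omega>. h (Z \<omega>) \<partial>N) < e / 3"
      using e by (intro tendstoD) auto
    then show "\<forall>\<^sub>F n in sequentially.
        dist (complex_of_real (\<integral>\<omega>. f (X n \<omega>) \<partial>M n)) (complex_of_real (\<integral>\<omega>. f (Z \<omega>) \<partial>N)) < e"
      using eventually_ge_at_top[of 1]
    proof eventually_elim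
      case (elim n)
      show ?case
        using dist_triangle[of "complex_of_real (\<integral>\<omega>. f (X n \<omega>) \<partial>M n)" "complex_of_real (\<integral>\<omega>. f (Z \<omega>) \<partial>N)"
            "\<integral>\<omega>. h (X n \<omega>) \<partial>M n"]
          dist_triangle[of "\<integral>\<omega>. h (X n \<omega>) \<partial>M n" "complex_of_real (\<integral>\<omega>. f (Z \<omega>) \<partial>N)" "\<integral>\<omega>. h (Z \<omega>) \<partial>N"]
          1[OF elim(2)] 2 elim(1) unfolding dist_norm
        by (simp only: norm_minus_commute[of "\<integral>\<omega>. h (Z \<omega>) \<partial>N"])
    qed
  qed
  then show "(\<lambda>n. \<integral>\<omega>. f (X n \<omega>) \<partial>M n) \<longlonglongrightarrow> (\<integral>\<omega>. f (Z \<omega>) \<partial>N)"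
    by (simp only: tendsto_of_real_iff)
qed

section \<open>Independent complex Gaussians\<close>

text \<open>The parameter is the second absolute moment for \<open>v\<close> at least 0: real and
  imaginary part are independent centred normals of variance \<open>v / 2\<close> each.\<close>

definition complex_gaussian :: "real \<Rightarrow> complex measure" where
  "complex_gaussian v = distr (std_normal_distribution \<Otimes>\<^sub>M std_normal_distribution) borel
     (\<lambda>(x, y). Complex (sqrt (v / 2) * x) (sqrt (v / 2) * y))"

lemma complex_gaussian_map_measurable:
  "(\<lambda>(x, y). Complex (c * x) (c * y)) \<in>
     borel_measurable (std_normal_distribution \<Otimes>\<^sub>M std_normal_distribution)"
proof -
  have "(\<lambda>(x, y). complex_of_real (c * x) + \<i> * complex_of_real (c * y)) \<in>
     borel_measurable (std_normal_distribution \<Otimes>\<^sub>M std_normal_distribution)"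
    by (simp add: split_beta')
  then show ?thesis by (simp add: Complex_eq split_beta')
qed

lemma sets_complex_gaussian [measurable_cong, simp]: "sets (complex_gaussian v) = sets borel"
  by (simp add: complex_gaussian_def)

lemma pair_prob_space_std_normal: "pair_prob_space std_normal_distribution std_normal_distribution"
proof -
  interpret real_distribution std_normal_distribution by (rule real_dist_normal_dist)
  show ?thesis by unfold_locales
qed

lemma prob_space_complex_gaussian: "prob_space (complex_gaussian v)"
proof -
  interpret pair_prob_space std_normal_distribution std_normal_distribution
    by (rule pair_prob_space_std_normal)
  show ?thesis
    unfolding complex_gaussian_def
    by (rule prob_space_distr[OF complex_gaussian_map_measurable])
qed

text \<open>The character splits into a factor for each real coordinate, so Fubini leaves two values
  of the standard normal characteristic function. The 4 is 2 from the split of the variance times 2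
  from the normal exponent.\<close>

lemma complex_gaussian_char:
  assumes "v \<ge> 0"
  shows "(\<integral>z. cis (Re (cnj \<zeta> * z)) \<partial>complex_gaussian v) = complex_of_real (exp (- (v * (norm \<zeta>)\<^sup>2) / 4))"
proof -
  let ?S = "std_normal_distribution" and ?c = "sqrt (v / 2)"
  interpret pair_prob_space ?S ?S by (rule pair_prob_space_std_normal)
  define f where "f p = iexp (?c * Re \<zeta> * fst p) * iexp (?c * Im \<zeta> * snd p)" for p :: "real \<times> real"
  have "cis (Re (cnj \<zeta> * Complex (?c * x) (?c * y))) = f (x, y)" for x y
    by (simp add: f_def cis_conv_exp exp_add[symmetric] algebra_simps)
  then have "(\<integral>z. cis (Re (cnj \<zeta> * z)) \<partial>complex_gaussian v) = (\<integral>p. f p \<partial>(?S \<Otimes>\<^sub>M ?S))"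
    unfolding complex_gaussian_def
    by (subst integral_distr[OF complex_gaussian_map_measurable])
       (auto intro!: borel_measurable_continuous_onI continuous_intros Bochner_Integration.integral_cong simp: split_beta')
  also have "\<dots> = (\<integral>x. (\<integral>y. f (x, y) \<partial>?S) \<partial>?S)"
  proof (rule integral_fst'[symmetric])
    have "f \<in> borel_measurable (?S \<Otimes>\<^sub>M ?S)" unfolding f_def by simp
    then show "integrable (?S \<Otimes>\<^sub>M ?S) f"
      by (intro P.integrable_const_bound[where B = 1]) (auto simp: f_def norm_mult)
  qed
  also have "\<dots> = char ?S (?c * Re \<zeta>) * char ?S (?c * Im \<zeta>)"
    by (simp add: f_def char_def)
  also have "\<dots> = complex_of_real (exp (- (?c * Re \<zeta>)\<^sup>2 / 2 + - (?c * Im \<zeta>)\<^sup>2 / 2))"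
    unfolding char_std_normal_distribution exp_add of_real_mult ..
  also have "- (?c * Re \<zeta>)\<^sup>2 / 2 + - (?c * Im \<zeta>)\<^sup>2 / 2 = - (v * (norm \<zeta>)\<^sup>2) / 4"
    using assms by (simp add: power_mult_distrib cmod_power2 field_simps)
  finally show ?thesis .
qed

lemma complex_gaussian_second_moment:
  assumes "v \<ge> 0"
  shows "integrable (complex_gaussian v) (\<lambda>z. (norm z)\<^sup>2)"
proof -
  let ?S = "std_normal_distribution" and ?c = "sqrt (v / 2)"
  interpret pair_prob_space ?S ?S by (rule pair_prob_space_std_normal)
  have i: "integrable ?S (\<lambda>x. x\<^sup>2)" by (rule integrable_std_normal_distribution_moment)
  have "integrable (?S \<Otimes>\<^sub>M ?S) (\<lambda>p. (v / 2) * ((fst p)\<^sup>2 + (snd p)\<^sup>2))"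
  proof (rule Fubini_integrable)
    show "integrable ?S (\<lambda>x. \<integral>y. norm (v / 2 * ((fst (x, y))\<^sup>2 + (snd (x, y))\<^sup>2)) \<partial>?S)"
      using assms i by (simp add: abs_mult)
    show "AE x in ?S. integrable ?S (\<lambda>y. v / 2 * ((fst (x, y))\<^sup>2 + (snd (x, y))\<^sup>2))"
      using i by simp
  qed simp
  moreover have "(norm (Complex (?c * x) (?c * y)))\<^sup>2 = (v / 2) * (x\<^sup>2 + y\<^sup>2)" for x y
    using assms by (simp add: cmod_power2 power_mult_distrib distrib_left)
  ultimately show ?thesis
    unfolding complex_gaussian_def
    by (intro iffD2[OF integrable_distr_eq[OF complex_gaussian_map_measurable]]) (simp, simp only: split_beta')
qed

definition gaussian_vector :: "nat set \<Rightarrow> (nat \<Rightarrow> complex) measure" where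
  "gaussian_vector I = PiM I (\<lambda>j. complex_gaussian (real j))"

lemma product_prob_space_gaussian: "product_prob_space (\<lambda>j. complex_gaussian (real j))"
  by (intro product_prob_spaceI prob_space_complex_gaussian)

lemma prob_space_gaussian_vector: "prob_space (gaussian_vector I)"
  unfolding gaussian_vector_def by (intro prob_space_PiM prob_space_complex_gaussian)

lemma sets_gaussian_vector [measurable_cong]: "sets (gaussian_vector I) = sets (PiM I (\<lambda>_. borel))"
  unfolding gaussian_vector_def by (intro sets_PiM_cong) auto

lemma gaussian_vector_component_measurable:
  "j \<in> I \<Longrightarrow> (\<lambda>\<omega>. \<omega> j) \<in> borel_measurable (gaussian_vector I)"
  using measurable_component_singleton[of j I "\<lambda>_. borel"]
  by (simp add: measurable_cong_sets[OF sets_gaussian_vector refl])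

lemma gaussian_vector_component_distr:
  assumes "j \<in> I"
  shows "distr (gaussian_vector I) borel (\<lambda>\<omega>. \<omega> j) = complex_gaussian (real j)"
proof -
  have "distr (gaussian_vector I) borel (\<lambda>\<omega>. \<omega> j) = distr (gaussian_vector I) (complex_gaussian (real j)) (\<lambda>\<omega>. \<omega> j)"
    by (intro distr_cong) auto
  also have "\<dots> = complex_gaussian (real j)"
    unfolding gaussian_vector_def by (rule distr_PiM_component[OF prob_space_complex_gaussian assms])
  finally show ?thesis .
qed

text \<open>Independence means that the joint law is the product of the marginals. Here the joint
  law of the coordinates is the product measure itself, since restricting an element of its space to
  \<open>I\<close> changes nothing.\<close>

lemma gaussian_vector_indep:
  assumes "I \<noteq> {}"
  shows "prob_space.indep_vars (gaussian_vector I) (\<lambda>_. borel) (\<lambda>j \<omega>. \<omega> j) I"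
proof -
  interpret prob_space "gaussian_vector I" by (rule prob_space_gaussian_vector)
  have "distr (gaussian_vector I) (PiM I (\<lambda>_. borel)) (\<lambda>\<omega>. \<lambda>j\<in>I. \<omega> j) = distr (gaussian_vector I) (gaussian_vector I) (\<lambda>\<omega>. \<omega>)"
  proof (rule distr_cong[OF refl])
    fix \<omega> assume "\<omega> \<in> space (gaussian_vector I)"
    then show "(\<lambda>j\<in>I. \<omega> j) = \<omega>"
      by (auto simp: gaussian_vector_def space_PiM PiE_iff extensional_restrict)
  qed (simp add: sets_gaussian_vector)
  also have "\<dots> = (\<Pi>\<^sub>M j\<in>I. distr (gaussian_vector I) borel (\<lambda>\<omega>. \<omega> j))"
    unfolding distr_id by (subst gaussian_vector_def) (intro PiM_cong refl, simp add: gaussian_vector_component_distr)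
  finally show ?thesis
    using gaussian_vector_component_measurable by (subst indep_vars_iff_distr_eq_PiM'[OF assms]) auto
qed

lemma gaussian_vector_second_moment:
  assumes "j \<in> I"
  shows "integrable (gaussian_vector I) (\<lambda>\<omega>. (norm (\<omega> j))\<^sup>2)"
  using complex_gaussian_second_moment[of "real j"]
    integrable_distr_eq[OF gaussian_vector_component_measurable[OF assms], of "\<lambda>z. (norm z)\<^sup>2"]
  by (simp add: gaussian_vector_component_distr[OF assms])

lemma gaussian_vector_char:
  assumes "finite I"
  shows "(\<integral>\<omega>. cis (\<Sum>j\<in>I. Re (cnj (\<xi> j) * \<omega> j)) \<partial>gaussian_vector I) =
    complex_of_real (exp (- (\<Sum>j\<in>I. j * (norm (\<xi> j))\<^sup>2) / 4))"
proof -
  interpret product_prob_space "\<lambda>j. complex_gaussian (real j)" UNIV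
    by (rule product_prob_space_gaussian)
  have "cis (\<Sum>j\<in>I. f j) = (\<Prod>j\<in>I. cis (f j))" for f
    using assms by (induction I rule: finite_induct) (simp_all flip: cis_mult)
  then have "(\<integral>\<omega>. cis (\<Sum>j\<in>I. Re (cnj (\<xi> j) * \<omega> j)) \<partial>gaussian_vector I) =
      (\<integral>\<omega>. (\<Prod>j\<in>I. cis (Re (cnj (\<xi> j) * \<omega> j))) \<partial>gaussian_vector I)" by (simp only:)
  also have "\<dots> = (\<Prod>j\<in>I. \<integral>z. cis (Re (cnj (\<xi> j) * z)) \<partial>complex_gaussian j)"
    unfolding gaussian_vector_def
  proof (rule product_integral_prod[OF assms])
    fix j :: nat
    have "(\<lambda>z. cis (Re (cnj (\<xi> j) * z))) \<in> borel_measurable borel"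
      by (intro borel_measurable_continuous_onI continuous_intros)
    then show "integrable (complex_gaussian (real j)) (\<lambda>z. cis (Re (cnj (\<xi> j) * z)))"
      by (intro finite_measure.integrable_const_bound[where B = 1] prob_space.finite_measure
          prob_space_complex_gaussian) auto
  qed
  also have "\<dots> = (\<Prod>j\<in>I. complex_of_real (exp (- (j * (norm (\<xi> j))\<^sup>2) / 4)))"
    by (intro prod.cong refl complex_gaussian_char) simp
  also have "\<dots> = complex_of_real (exp (\<Sum>j\<in>I. - (j * (norm (\<xi> j))\<^sup>2) / 4))"
    using assms by (simp add: exp_sum)
  finally show ?thesis by (simp add: sum_negf sum_divide_distrib)
qed

section \<open>The unitary group and its Haar measure\<close>

lemma mat_adjoint_carrier: "A \<in> carrier_mat n m \<Longrightarrow> mat_adjoint A \<in> carrier_mat m n"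
  unfolding mat_adjoint_def by (auto simp: mat_of_rows_def)

lemma mat_adjoint_index:
  fixes A :: "complex mat"
  assumes "A \<in> carrier_mat n m" "i < m" "j < n"
  shows "mat_adjoint A $$ (i, j) = cnj (A $$ (j, i))"
  using assms unfolding mat_adjoint_def by (auto simp: mat_of_rows_index)

lemma index_mult_mat_sum:
  assumes "A \<in> carrier_mat n m" "B \<in> carrier_mat m k" "i < n" "j < k"
  shows "(A * B) $$ (i, j) = (\<Sum>c<m. A $$ (i, c) * B $$ (c, j))"
  using assms by (auto simp: scalar_prod_def lessThan_atLeast0 intro!: sum.cong)

lemma unitary_group_carrier: "A \<in> unitary_group n \<Longrightarrow> A \<in> carrier_mat n n"
  by (simp add: unitary_group_def)

lemma mat_adjoint_mult:
  fixes A B :: "complex mat"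
  assumes "A \<in> carrier_mat n m" "B \<in> carrier_mat m k"
  shows "mat_adjoint (A * B) = mat_adjoint B * mat_adjoint A"
proof (rule eq_matI)
  note [simp] = carrier_matD[OF mat_adjoint_carrier[OF assms(1)]] carrier_matD[OF mat_adjoint_carrier[OF assms(2)]]
    carrier_matD[OF mat_adjoint_carrier[OF mult_carrier_mat[OF assms]]]
  show "dim_row (mat_adjoint (A * B)) = dim_row (mat_adjoint B * mat_adjoint A)"
    "dim_col (mat_adjoint (A * B)) = dim_col (mat_adjoint B * mat_adjoint A)"
    by simp_all
  fix i j assume "i < dim_row (mat_adjoint B * mat_adjoint A)" "j < dim_col (mat_adjoint B * mat_adjoint A)"
  then have ij: "i < k" "j < n" by simp_all
  have "mat_adjoint (A * B) $$ (i, j) = cnj (\<Sum>c<m. A $$ (j, c) * B $$ (c, i))"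
    using mat_adjoint_index[OF mult_carrier_mat[OF assms] ij] index_mult_mat_sum[OF assms ij(2,1)] by simp
  also have "\<dots> = (\<Sum>c<m. mat_adjoint B $$ (i, c) * mat_adjoint A $$ (c, j))"
    using assms ij by (simp add: mat_adjoint_index mult.commute)
  also have "\<dots> = (mat_adjoint B * mat_adjoint A) $$ (i, j)"
    using index_mult_mat_sum[OF mat_adjoint_carrier[OF assms(2)] mat_adjoint_carrier[OF assms(1)] ij] by simp
  finally show "mat_adjoint (A * B) $$ (i, j) = (mat_adjoint B * mat_adjoint A) $$ (i, j)" .
qed

lemma unitary_group_mult:
  assumes "A \<in> unitary_group n" "B \<in> unitary_group n"
  shows "A * B \<in> unitary_group n"
proof -
  note c = assms[THEN unitary_group_carrier] and d = assms[THEN unitary_group_carrier, THEN mat_adjoint_carrier]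
  have "A * B * mat_adjoint (A * B) = A * (B * mat_adjoint B) * mat_adjoint A"
    unfolding mat_adjoint_mult[OF c]
    using c d by (simp add: assoc_mult_mat[of _ n n _ n _ n])
  moreover have "mat_adjoint (A * B) * (A * B) = mat_adjoint B * (mat_adjoint A * A) * B"
    unfolding mat_adjoint_mult[OF c]
    using c d by (simp add: assoc_mult_mat[of _ n n _ n _ n])
  ultimately show ?thesis
    using assms c d unfolding unitary_group_def by auto
qed

lemma unitary_group_one: "1\<^sub>m n \<in> unitary_group n"
proof -
  have "mat_adjoint (1\<^sub>m n) = (1\<^sub>m n :: complex mat)"
    by (rule eq_matI) (auto simp: mat_adjoint_index[OF one_carrier_mat]
       carrier_matD[OF mat_adjoint_carrier[OF one_carrier_mat]])
  then show ?thesis by (simp add: unitary_group_def)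
qed

lemma unitary_group_pow: "A \<in> unitary_group n \<Longrightarrow> A ^\<^sub>m k \<in> unitary_group n"
  by (induction k) (auto simp: unitary_group_one unitary_group_mult dest: unitary_group_carrier)

lemma unitary_group_rows:
  assumes "A \<in> unitary_group n" "a < n" "b < n"
  shows "(\<Sum>c<n. A $$ (a, c) * cnj (A $$ (b, c))) = (if a = b then 1 else 0)"
proof -
  note c = unitary_group_carrier[OF assms(1)]
  have "(A * mat_adjoint A) $$ (a, b) = (\<Sum>c<n. A $$ (a, c) * cnj (A $$ (b, c)))"
    using assms c by (simp add: index_mult_mat_sum[OF c mat_adjoint_carrier[OF c]] mat_adjoint_index)
  then show ?thesis using assms by (simp add: unitary_group_def)
qed

text \<open>Each row is a unit vector. From this come the bounds on powers and on their
  traces.\<close>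

lemma unitary_group_entry_le_1:
  assumes "A \<in> unitary_group n" "a < n" "b < n"
  shows "norm (A $$ (a, b)) \<le> 1"
proof -
  have "complex_of_real (\<Sum>c<n. (norm (A $$ (a, c)))\<^sup>2) = 1"
    using unitary_group_rows[OF assms(1,2,2)] by (simp only: of_real_sum complex_norm_square) simp
  then have "(\<Sum>c<n. (norm (A $$ (a, c)))\<^sup>2) = 1" by (simp only: of_real_eq_1_iff)
  moreover have "(norm (A $$ (a, b)))\<^sup>2 \<le> (\<Sum>c<n. (norm (A $$ (a, c)))\<^sup>2)"
    using assms(3) by (intro member_le_sum) auto
  ultimately show ?thesis by (simp add: power_le_one_iff)
qed

lemma pow_mat_add:
  assumes "A \<in> carrier_mat n n"
  shows "A ^\<^sub>m (i + j) = A ^\<^sub>m i * A ^\<^sub>m j"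
proof (induction j)
  case 0
  then show ?case using assms by simp
next
  case (Suc j)
  then show ?case using assms by (simp add: assoc_mult_mat[of _ n n _ n _ n])
qed

text \<open>The one-parameter group \<open>exp (\<i> t v v\<^sup>*)\<close> for a unit vector \<open>v\<close>.\<close>

definition phase_mat :: "nat \<Rightarrow> (nat \<Rightarrow> complex) \<Rightarrow> real \<Rightarrow> complex mat" where
  "phase_mat n v t = mat n n (\<lambda>(a, b). (if a = b then 1 else 0) + (cis t - 1) * (v a * cnj (v b)))"

definition unit_vector :: "nat \<Rightarrow> (nat \<Rightarrow> complex) \<Rightarrow> bool" where
  "unit_vector n v \<longleftrightarrow> (\<Sum>i<n. v i * cnj (v i)) = 1"

lemma phase_mat_carrier [simp]: "phase_mat n v t \<in> carrier_mat n n"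
  by (simp add: phase_mat_def)

lemma phase_mat_0: "phase_mat n v 0 = 1\<^sub>m n"
  by (rule eq_matI) (auto simp: phase_mat_def)

lemma phase_mat_mult_index:
  assumes "A \<in> carrier_mat n m" "a < n" "b < m"
  shows "(phase_mat n v t * A) $$ (a, b) = A $$ (a, b) + (cis t - 1) * (v a * (\<Sum>c<n. cnj (v c) * A $$ (c, b)))"
proof -
  have "(phase_mat n v t * A) $$ (a, b) =
      (\<Sum>c<n. (if c = a then A $$ (c, b) else 0) + (cis t - 1) * (v a * (cnj (v c) * A $$ (c, b))))"
    unfolding index_mult_mat_sum[OF phase_mat_carrier assms]
    using assms by (intro sum.cong) (auto simp: phase_mat_def algebra_simps)
  also have "\<dots> = A $$ (a, b) + (cis t - 1) * (v a * (\<Sum>c<n. cnj (v c) * A $$ (c, b)))"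
    using assms by (simp add: sum.distrib sum_distrib_left)
  finally show ?thesis .
qed

text \<open>For a unit vector, \<open>v a * cnj (v b)\<close> are the entries of a projection P, and
  the matrix is \<open>(1 - P) + cis t P\<close>; such matrices multiply through their eigenvalue
  \<open>cis t\<close>.\<close>

lemma phase_mat_mult:
  assumes "unit_vector n v"
  shows "phase_mat n v s * phase_mat n v t = phase_mat n v (s + t)"
proof (rule eq_matI)
  fix a b assume "a < dim_row (phase_mat n v (s + t))" "b < dim_col (phase_mat n v (s + t))"
  then have ab: "a < n" "b < n" by (simp_all add: phase_mat_def)
  have "(\<Sum>c<n. cnj (v c) * phase_mat n v t $$ (c, b))
      = (\<Sum>c<n. (if c = b then cnj (v c) else 0) + (cis t - 1) * cnj (v b) * (v c * cnj (v c)))"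
    using ab by (intro sum.cong) (auto simp: phase_mat_def algebra_simps)
  also have "\<dots> = cnj (v b) + (cis t - 1) * cnj (v b) * (\<Sum>c<n. v c * cnj (v c))"
    using ab by (simp add: sum.distrib sum_distrib_left)
  also have "\<dots> = cis t * cnj (v b)"
    using assms by (simp add: unit_vector_def algebra_simps)
  finally have "(phase_mat n v s * phase_mat n v t) $$ (a, b) =
      phase_mat n v t $$ (a, b) + (cis s - 1) * (v a * (cis t * cnj (v b)))"
    using ab by (simp add: phase_mat_mult_index[where m = n])
  also have "\<dots> = phase_mat n v (s + t) $$ (a, b)"
    using ab by (simp add: phase_mat_def cis_mult[symmetric] algebra_simps)
  finally show "(phase_mat n v s * phase_mat n v t) $$ (a, b) = phase_mat n v (s + t) $$ (a, b)" .
qed (auto simp: phase_mat_def)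

lemma phase_mat_unitary:
  assumes "unit_vector n v"
  shows "phase_mat n v t \<in> unitary_group n"
proof -
  have "mat_adjoint (phase_mat n v t) = phase_mat n v (- t)"
  proof (rule eq_matI)
    fix i j assume "i < dim_row (phase_mat n v (- t))" "j < dim_col (phase_mat n v (- t))"
    then have ij: "i < n" "j < n" by (simp_all add: phase_mat_def)
    have "mat_adjoint (phase_mat n v t) $$ (i, j) = cnj (phase_mat n v t $$ (j, i))"
      by (rule mat_adjoint_index[OF phase_mat_carrier ij])
    also have "\<dots> = phase_mat n v (- t) $$ (i, j)"
      using ij by (simp add: phase_mat_def cis_cnj)
    finally show "mat_adjoint (phase_mat n v t) $$ (i, j) = phase_mat n v (- t) $$ (i, j)" .
  qed (simp_all only: carrier_matD[OF mat_adjoint_carrier[OF phase_mat_carrier]] carrier_matD[OF phase_mat_carrier])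
  then show ?thesis
    using assms by (simp add: unitary_group_def phase_mat_mult phase_mat_0)
qed

section \<open>Borel structure and invariance of the unitary group\<close>

lemma unitary_entry_continuous:
  assumes "a < n" "b < n"
  shows "continuous_map (unitary_topology n) euclidean (\<lambda>A. A $$ (a, b))"
proof -
  have "continuous_map (unitary_topology n) euclidean ((\<lambda>x. x (a, b)) \<circ> mat_entries n)"
    unfolding unitary_topology_def
    by (intro continuous_map_pullback continuous_map_product_projection) (use assms in auto)
  moreover have "((\<lambda>x. x (a, b)) \<circ> mat_entries n) = (\<lambda>A. A $$ (a, b))"
    using assms by (auto simp: mat_entries_def)
  ultimately show ?thesis by simp
qed

lemma continuous_map_unitary_measurable:
  fixes f :: "complex mat \<Rightarrow> 'b::topological_space"
  assumes "continuous_map (unitary_topology n) euclidean f"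
  shows "f \<in> borel_measurable (unitary_borel n)"
proof (rule borel_measurableI)
  fix S :: "'b set" assume "open S"
  then have "openin (unitary_topology n) {x \<in> topspace (unitary_topology n). f x \<in> S}"
    using assms by (intro openin_continuous_map_preimage) auto
  then show "f -` S \<inter> space (unitary_borel n) \<in> sets (unitary_borel n)"
    by (auto simp: sets_unitary_borel vimage_def Int_def conj_commute)
qed

lemma unitary_left_mult_measurable:
  assumes V: "V \<in> unitary_group n"
  shows "(\<lambda>A. V * A) \<in> measurable (unitary_borel n) (unitary_borel n)"
proof (rule measurable_sigma_sets[OF sets_unitary_borel])
  \<comment> \<open>Continuity into a pullback topology is continuity of the array of entries, and
    each entry of \<open>V * A\<close> is a linear combination of entries of
    \<open>A\<close>.\<close>
  have c: "continuous_map (unitary_topology n) (unitary_topology n) (\<lambda>A. V * A)"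
  proof -
    have "continuous_map (unitary_topology n) (product_topology (\<lambda>_. euclidean) ({..<n} \<times> {..<n}))
      (mat_entries n \<circ> (\<lambda>A. V * A))"
      unfolding continuous_map_componentwise
    proof (intro conjI ballI)
      show "(mat_entries n \<circ> (*) V) ` topspace (unitary_topology n) \<subseteq> extensional ({..<n} \<times> {..<n})"
        by (auto simp: mat_entries_def)
      fix k :: "nat \<times> nat" assume k: "k \<in> {..<n} \<times> {..<n}"
      obtain a b where [simp]: "k = (a, b)" by (cases k)
      have "continuous_map (unitary_topology n) euclidean (\<lambda>A. \<Sum>c<n. V $$ (a, c) * A $$ (c, b))"
      proof (intro continuous_map_sum)
        fix c assume "c \<in> {..<n}"
        with k have "continuous_map (unitary_topology n) euclidean (\<lambda>A. A $$ (c, b))"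
          by (intro unitary_entry_continuous) auto
        moreover have "continuous_map euclidean euclidean (\<lambda>z. V $$ (a, c) * z)"
          by (auto intro!: continuous_intros)
        ultimately show "continuous_map (unitary_topology n) euclidean (\<lambda>A. V $$ (a, c) * A $$ (c, b))"
          by (rule continuous_map_compose[unfolded comp_def])
      qed simp
      then show "continuous_map (unitary_topology n) euclidean (\<lambda>x. (mat_entries n \<circ> (*) V) x k)"
        by (rule continuous_map_eq)
          (use k V in \<open>auto simp: mat_entries_def index_mult_mat_sum[where n = n and m = n and k = n] simp del: index_mult_mat(1) dest!: unitary_group_carrier\<close>)
    qed
    then show ?thesis
      using unitary_group_mult[OF V] unfolding unitary_topology_def
      by (intro continuous_map_pullback') (auto simp: topspace_pullback_topology)
  qed
  fix S assume "S \<in> {S. openin (unitary_topology n) S}"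
  with c have "openin (unitary_topology n) {x \<in> topspace (unitary_topology n). V * x \<in> S}"
    by (intro openin_continuous_map_preimage) auto
  then show "(*) V -` S \<inter> space (unitary_borel n) \<in> sets (unitary_borel n)"
    by (auto simp: sets_unitary_borel vimage_def Int_def conj_commute)
qed (use unitary_group_mult[OF V] openin_subset in fastforce)+

lemma space_unitary_haar: "unitary_haar n \<mu> \<Longrightarrow> space \<mu> = unitary_group n"
  using sets_eq_imp_space_eq[of \<mu> "unitary_borel n"] by (simp add: unitary_haar_def)

text \<open>Invariance is assumed for images, while a distribution is computed from preimages. The
  two agree because \<open>mat_adjoint V\<close> inverts translation by \<open>V\<close>, so
  \<open>S\<close> is the image of its own preimage.\<close>

lemma unitary_haar_distr:
  assumes "unitary_haar n \<mu>" "V \<in> unitary_group n"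
  shows "distr \<mu> \<mu> (\<lambda>A. V * A) = \<mu>"
proof (rule measure_eqI)
  have sp: "sets \<mu> = sets (unitary_borel n)" "space \<mu> = unitary_group n"
    using assms(1) sets_eq_imp_space_eq[of \<mu> "unitary_borel n"] by (auto simp: unitary_haar_def)
  have meas: "(\<lambda>A. V * A) \<in> measurable \<mu> \<mu>"
    using unitary_left_mult_measurable[OF assms(2)] sp(1) by (simp cong: measurable_cong_sets)
  fix S assume "S \<in> sets (distr \<mu> \<mu> (\<lambda>A. V * A))"
  then have S: "S \<in> sets \<mu>" by simp
  define T where "T = (\<lambda>A. V * A) -` S \<inter> space \<mu>"
  have T: "T \<in> sets (unitary_borel n)" using measurable_sets[OF meas S] sp by (simp add: T_def)
  have "(\<lambda>A. V * A) ` T = S"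
  proof (intro equalityI subsetI)
    fix B assume B: "B \<in> S"
    then have Bu: "B \<in> unitary_group n" using S sets.sets_into_space sp by blast
    have ad: "mat_adjoint V \<in> unitary_group n"
    proof -
      note c = unitary_group_carrier[OF assms(2)] mat_adjoint_carrier[OF unitary_group_carrier[OF assms(2)]]
      have "mat_adjoint (mat_adjoint V) = V"
        using c by (intro eq_matI) (auto simp: mat_adjoint_index[where n = n and m = n] carrier_matD[OF mat_adjoint_carrier[OF c(2)]])
      then show ?thesis using assms(2) c by (auto simp: unitary_group_def)
    qed
    have "V * (mat_adjoint V * B) = V * mat_adjoint V * B"
      using assms(2) ad Bu by (intro assoc_mult_mat[symmetric]) (auto intro: unitary_group_carrier)
    also have "\<dots> = B" using assms(2) unitary_group_carrier[OF Bu] by (simp add: unitary_group_def)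
    finally show "B \<in> (\<lambda>A. V * A) ` T"
      using B unitary_group_mult[OF ad Bu] by (intro image_eqI[of _ _ "mat_adjoint V * B"]) (auto simp: T_def sp)
  qed (auto simp: T_def)
  then have "emeasure \<mu> S = emeasure \<mu> T"
    using assms T unfolding unitary_haar_def by metis
  then show "emeasure (distr \<mu> \<mu> (\<lambda>A. V * A)) S = emeasure \<mu> S"
    using S meas by (simp add: emeasure_distr T_def)
qed simp

section \<open>Gradients and integration by parts\<close>

text \<open>A class of test functions closed under the algebra needed here and integrable for Haar
  measure. The bound is uniform on the group, so it persists along the flow
  \<open>phase_mat n v t * A\<close>, as differentiation under the integral requires.\<close>

definition bounded_measurable :: "nat \<Rightarrow> (complex mat \<Rightarrow> complex) \<Rightarrow> bool" where
  "bounded_measurable n F \<longleftrightarrow> F \<in> borel_measurable (unitary_borel n) \<and>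
     (\<exists>B. \<forall>A\<in>unitary_group n. norm (F A) \<le> B)"

lemma bounded_measurable_const: "bounded_measurable n (\<lambda>_. c)"
  by (auto simp: bounded_measurable_def)

lemma bounded_measurable_add:
  assumes "bounded_measurable n F" "bounded_measurable n G"
  shows "bounded_measurable n (\<lambda>A. F A + G A)"
proof -
  obtain B C where "\<And>A. A \<in> unitary_group n \<Longrightarrow> norm (F A) \<le> B" "\<And>A. A \<in> unitary_group n \<Longrightarrow> norm (G A) \<le> C"
    using assms by (auto simp: bounded_measurable_def)
  then have "\<And>A. A \<in> unitary_group n \<Longrightarrow> norm (F A + G A) \<le> B + C"
    by (meson norm_triangle_le add_mono)
  with assms show ?thesis by (auto simp: bounded_measurable_def)
qed

lemma bounded_measurable_mult:
  assumes "bounded_measurable n F" "bounded_measurable n G"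
  shows "bounded_measurable n (\<lambda>A. F A * G A)"
proof -
  obtain B C where BC: "\<And>A. A \<in> unitary_group n \<Longrightarrow> norm (F A) \<le> B" "\<And>A. A \<in> unitary_group n \<Longrightarrow> norm (G A) \<le> C"
    using assms by (auto simp: bounded_measurable_def)
  have "norm (F A * G A) \<le> B * C" if "A \<in> unitary_group n" for A
    unfolding norm_mult using BC[OF that] by (intro mult_mono) (auto intro: order_trans[OF norm_ge_zero])
  with assms show ?thesis by (auto simp: bounded_measurable_def)
qed

lemma bounded_measurable_sum:
  assumes "\<And>c. c \<in> C \<Longrightarrow> bounded_measurable n (F c)"
  shows "bounded_measurable n (\<lambda>A. \<Sum>c\<in>C. F c A)"
  using assms
  by (induction C rule: infinite_finite_induct) (auto intro: bounded_measurable_const bounded_measurable_add)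

lemma bounded_measurable_cnj:
  assumes "bounded_measurable n F"
  shows "bounded_measurable n (\<lambda>A. cnj (F A))"
proof -
  have "cnj \<in> borel_measurable borel" by (intro borel_measurable_continuous_onI continuous_intros)
  then show ?thesis
    using assms by (auto simp: bounded_measurable_def intro: measurable_compose)
qed

lemma bounded_measurable_exp:
  assumes "bounded_measurable n F"
  shows "bounded_measurable n (\<lambda>A. exp (F A))"
proof -
  obtain B where B: "\<And>A. A \<in> unitary_group n \<Longrightarrow> norm (F A) \<le> B"
    using assms by (auto simp: bounded_measurable_def)
  have "norm (exp (F A)) \<le> exp B" if "A \<in> unitary_group n" for A
    using norm_exp[of "F A"] B[OF that] by (meson exp_le_cancel_iff order_trans)
  moreover have "(exp :: complex \<Rightarrow> complex) \<in> borel_measurable borel"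
    by (intro borel_measurable_continuous_onI continuous_intros)
  ultimately show ?thesis
    using assms by (auto simp: bounded_measurable_def intro: measurable_compose)
qed

text \<open>Matrix identities, such as the value of \<open>A ^\<^sub>m 0\<close>, depend on the
  dimension of \<open>A\<close> and are available only on the unitary group.\<close>

lemma bounded_measurable_cong:
  assumes "\<And>A. A \<in> unitary_group n \<Longrightarrow> F A = F' A"
  shows "bounded_measurable n F \<longleftrightarrow> bounded_measurable n F'"
  using assms measurable_cong[of "unitary_borel n" F F' borel] by (simp add: bounded_measurable_def)

lemma bounded_measurable_entry:
  assumes "a < n" "b < n"
  shows "bounded_measurable n (\<lambda>A. A $$ (a, b))"
  unfolding bounded_measurable_def
  using assms unitary_group_entry_le_1
  by (intro conjI exI[of _ 1] ballI continuous_map_unitary_measurable[OF unitary_entry_continuous]) auto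

lemma pow_mat_Suc_index:
  assumes "A \<in> unitary_group n" "a < n" "b < n"
  shows "(A ^\<^sub>m Suc k) $$ (a, b) = (\<Sum>c<n. (A ^\<^sub>m k) $$ (a, c) * A $$ (c, b))"
  using assms index_mult_mat_sum[of "A ^\<^sub>m k" n n A n a b]
  by (simp add: unitary_group_carrier unitary_group_pow)

lemma bounded_measurable_pow_entry:
  assumes "a < n" "b < n"
  shows "bounded_measurable n (\<lambda>A. (A ^\<^sub>m k) $$ (a, b))"
  using assms(2)
proof (induction k arbitrary: b)
  case 0
  have "bounded_measurable n (\<lambda>A. (A ^\<^sub>m 0) $$ (a, b)) \<longleftrightarrow> bounded_measurable n (\<lambda>A. 1\<^sub>m n $$ (a, b))"
    by (rule bounded_measurable_cong) (auto dest!: unitary_group_carrier)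
  then show ?case by (simp only: bounded_measurable_const)
next
  case (Suc k)
  have "bounded_measurable n (\<lambda>A. \<Sum>c<n. (A ^\<^sub>m k) $$ (a, c) * A $$ (c, b))"
    using Suc by (intro bounded_measurable_sum bounded_measurable_mult bounded_measurable_entry) auto
  then show ?case
    using pow_mat_Suc_index[OF _ assms(1) Suc.prems] by (subst bounded_measurable_cong)
qed

lemma bounded_measurable_integrable:
  assumes "unitary_haar n \<mu>" "bounded_measurable n F"
  shows "integrable \<mu> F"
proof -
  from assms(1) interpret prob_space \<mu> by (simp add: unitary_haar_def)
  have s: "sets \<mu> = sets (unitary_borel n)" using assms by (simp add: unitary_haar_def)
  obtain B where "\<And>A. A \<in> unitary_group n \<Longrightarrow> norm (F A) \<le> B"
    using assms by (auto simp: bounded_measurable_def)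
  moreover have "space \<mu> = unitary_group n" by (rule space_unitary_haar[OF assms(1)])
  ultimately show ?thesis
    using assms(2) s
    by (intro integrable_const_bound[where B = B]) (auto simp: bounded_measurable_def cong: measurable_cong_sets)
qed

text \<open>\<open>g i j\<close> is the derivative of \<open>F\<close> at \<open>A\<close> in the direction \<open>E\<^sub>i\<^sub>j A\<close>, so the flow
  \<open>exp (\<i> t v v\<^sup>*) A\<close> differentiates \<open>F\<close> to \<open>\<i> \<Sum> v\<^sub>i cnj v\<^sub>j g i j\<close>.\<close>

definition has_gradient ::
    "nat \<Rightarrow> (complex mat \<Rightarrow> complex) \<Rightarrow> (nat \<Rightarrow> nat \<Rightarrow> complex mat \<Rightarrow> complex) \<Rightarrow> bool" where
  "has_gradient n F g \<longleftrightarrow> bounded_measurable n F \<and>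
     (\<forall>i<n. \<forall>j<n. bounded_measurable n (g i j)) \<and>
     (\<forall>A\<in>unitary_group n. \<forall>v. unit_vector n v \<longrightarrow>
        ((\<lambda>t. F (phase_mat n v t * A)) has_vector_derivative
           \<i> * (\<Sum>i<n. \<Sum>j<n. v i * cnj (v j) * g i j A)) (at 0))"

lemma has_gradientD:
  assumes "has_gradient n F g" "A \<in> unitary_group n" "unit_vector n v"
  shows "((\<lambda>t. F (phase_mat n v t * A)) has_vector_derivative
           \<i> * (\<Sum>i<n. \<Sum>j<n. v i * cnj (v j) * g i j A)) (at 0)"
  using assms by (auto simp: has_gradient_def)

text \<open>The flow by \<open>phase_mat\<close> stays in the group, so no value of \<open>F\<close>
  elsewhere enters.\<close>

lemma has_gradient_cong:
  assumes "\<And>A. A \<in> unitary_group n \<Longrightarrow> F A = F' A"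
    and "\<And>A i j. A \<in> unitary_group n \<Longrightarrow> i < n \<Longrightarrow> j < n \<Longrightarrow> g i j A = g' i j A"
  shows "has_gradient n F g \<longleftrightarrow> has_gradient n F' g'"
proof -
  have "F (phase_mat n v t * A) = F' (phase_mat n v t * A)" if "A \<in> unitary_group n" "unit_vector n v" for A v t
    using that by (intro assms(1) unitary_group_mult phase_mat_unitary)
  moreover have "(\<Sum>i<n. \<Sum>j<n. v i * cnj (v j) * g i j A) = (\<Sum>i<n. \<Sum>j<n. v i * cnj (v j) * g' i j A)"
    if "A \<in> unitary_group n" for A v
    using assms(2)[OF that] by simp
  ultimately show ?thesis
    using assms bounded_measurable_cong[of n F F'] bounded_measurable_cong[of n "g i j" "g' i j" for i j]
    unfolding has_gradient_def by (simp cong: conj_cong)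
qed

lemma has_gradient_const: "has_gradient n (\<lambda>_. c) (\<lambda>_ _ _. 0)"
  by (simp add: has_gradient_def bounded_measurable_const)

lemma has_gradient_add:
  assumes "has_gradient n F f" "has_gradient n G g"
  shows "has_gradient n (\<lambda>A. F A + G A) (\<lambda>i j A. f i j A + g i j A)"
  unfolding has_gradient_def
proof (intro conjI allI impI ballI)
  fix A v assume "A \<in> unitary_group n" "unit_vector n v"
  from has_vector_derivative_add[OF has_gradientD[OF assms(1) this] has_gradientD[OF assms(2) this]]
  show "((\<lambda>t. F (phase_mat n v t * A) + G (phase_mat n v t * A)) has_vector_derivative
           \<i> * (\<Sum>i<n. \<Sum>j<n. v i * cnj (v j) * (f i j A + g i j A))) (at 0)"
    by (simp only: distrib_left sum.distrib)
qed (use assms in \<open>auto simp: has_gradient_def intro: bounded_measurable_add\<close>)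

lemma has_gradient_mult:
  assumes "has_gradient n F f" "has_gradient n G g"
  shows "has_gradient n (\<lambda>A. F A * G A) (\<lambda>i j A. F A * g i j A + f i j A * G A)"
  unfolding has_gradient_def
proof (intro conjI allI impI ballI)
  fix A v assume A: "A \<in> unitary_group n" "unit_vector n v"
  have 1: "phase_mat n v 0 * A = A"
    using unitary_group_carrier[OF A(1)] by (simp add: phase_mat_0)
  have "\<i> * (\<Sum>i<n. \<Sum>j<n. v i * cnj (v j) * (F A * g i j A + f i j A * G A))
      = F A * (\<i> * (\<Sum>i<n. \<Sum>j<n. v i * cnj (v j) * g i j A)) + \<i> * (\<Sum>i<n. \<Sum>j<n. v i * cnj (v j) * f i j A) * G A"
    by (simp add: sum_distrib_left sum_distrib_right sum.distrib distrib_left mult_ac)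
  with has_vector_derivative_mult[OF has_gradientD[OF assms(1) A] has_gradientD[OF assms(2) A]]
  show "((\<lambda>t. F (phase_mat n v t * A) * G (phase_mat n v t * A)) has_vector_derivative
           \<i> * (\<Sum>i<n. \<Sum>j<n. v i * cnj (v j) * (F A * g i j A + f i j A * G A))) (at 0)"
    by (simp only: 1)
qed (use assms in \<open>auto simp: has_gradient_def intro!: bounded_measurable_add bounded_measurable_mult\<close>)

lemma has_gradient_sum:
  assumes "\<And>c. c \<in> C \<Longrightarrow> has_gradient n (F c) (f c)"
  shows "has_gradient n (\<lambda>A. \<Sum>c\<in>C. F c A) (\<lambda>i j A. \<Sum>c\<in>C. f c i j A)"
  using assms
  by (induction C rule: infinite_finite_induct) (auto intro: has_gradient_const has_gradient_add)

lemma has_gradient_cmult: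
  assumes "has_gradient n F f"
  shows "has_gradient n (\<lambda>A. c * F A) (\<lambda>i j A. c * f i j A)"
  using has_gradient_mult[OF has_gradient_const assms, of c] by simp

text \<open>Conjugation turns the prefactor \<open>\<i>\<close> into its negative and exchanges the
  roles of \<open>v i\<close> and \<open>cnj (v j)\<close>; hence the sign and the transposed
  indices.\<close>

lemma has_gradient_cnj:
  assumes "has_gradient n F f"
  shows "has_gradient n (\<lambda>A. cnj (F A)) (\<lambda>i j A. - cnj (f j i A))"
  unfolding has_gradient_def
proof (intro conjI allI impI ballI)
  fix A v assume A: "A \<in> unitary_group n" "unit_vector n v"
  have "cnj (\<i> * (\<Sum>i<n. \<Sum>j<n. v i * cnj (v j) * f i j A)) = \<i> * (\<Sum>i<n. \<Sum>j<n. v j * cnj (v i) * - cnj (f i j A))"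
    by (simp add: sum_negf mult_ac)
  also have "\<dots> = \<i> * (\<Sum>i<n. \<Sum>j<n. v i * cnj (v j) * - cnj (f j i A))"
    by (subst sum.swap) (rule refl)
  finally show "((\<lambda>t. cnj (F (phase_mat n v t * A))) has_vector_derivative
           \<i> * (\<Sum>i<n. \<Sum>j<n. v i * cnj (v j) * - cnj (f j i A))) (at 0)"
    using bounded_linear.has_vector_derivative[OF bounded_linear_cnj has_gradientD[OF assms A]] by (simp only:)
next
  fix i j assume "i < n" "j < n"
  then have "bounded_measurable n (\<lambda>A. (-1) * cnj (f j i A))"
    using assms by (intro bounded_measurable_mult bounded_measurable_const bounded_measurable_cnj) (auto simp: has_gradient_def)
  then show "bounded_measurable n (\<lambda>A. - cnj (f j i A))" by simp
qed (use assms in \<open>auto simp: has_gradient_def intro: bounded_measurable_cnj\<close>)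

lemma has_gradient_exp:
  assumes "has_gradient n F f"
  shows "has_gradient n (\<lambda>A. exp (F A)) (\<lambda>i j A. exp (F A) * f i j A)"
  unfolding has_gradient_def
proof (intro conjI allI impI ballI)
  fix A v assume A: "A \<in> unitary_group n" "unit_vector n v"
  have 1: "phase_mat n v 0 * A = A"
    using unitary_group_carrier[OF A(1)] by (simp add: phase_mat_0)
  have "\<i> * (\<Sum>i<n. \<Sum>j<n. v i * cnj (v j) * (exp (F A) * f i j A))
      = \<i> * (\<Sum>i<n. \<Sum>j<n. v i * cnj (v j) * f i j A) * exp (F A)"
    by (simp add: sum_distrib_left sum_distrib_right mult_ac)
  with field_vector_diff_chain_at[OF has_gradientD[OF assms A] DERIV_exp]
  show "((\<lambda>t. exp (F (phase_mat n v t * A))) has_vector_derivative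
           \<i> * (\<Sum>i<n. \<Sum>j<n. v i * cnj (v j) * (exp (F A) * f i j A))) (at 0)"
    by (simp only: 1 comp_def)
qed (use assms in \<open>auto simp: has_gradient_def intro: bounded_measurable_exp bounded_measurable_mult\<close>)

lemma has_gradient_entry:
  assumes "a < n" "b < n"
  shows "has_gradient n (\<lambda>A. A $$ (a, b)) (\<lambda>i j A. (if i = a then 1 else 0) * A $$ (j, b))"
  unfolding has_gradient_def
proof (intro conjI allI impI ballI)
  fix A v assume A: "A \<in> unitary_group n" "unit_vector n v"
  have "((\<lambda>t. A $$ (a, b) + (cis t - 1) * (v a * (\<Sum>c<n. cnj (v c) * A $$ (c, b)))) has_vector_derivative
      0 + (\<i> * cis 0 - 0) * (v a * (\<Sum>c<n. cnj (v c) * A $$ (c, b)))) (at 0)"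
    by (intro derivative_intros) (auto simp: cis_conv_exp intro!: derivative_eq_intros)
  moreover have "\<i> * (\<Sum>i<n. \<Sum>j<n. v i * cnj (v j) * ((if i = a then 1 else 0) * A $$ (j, b)))
     = \<i> * (\<Sum>i<n. if i = a then \<Sum>j<n. v i * cnj (v j) * A $$ (j, b) else 0)"
    by (intro arg_cong2[where f = "(*)"] sum.cong) auto
  moreover have "\<dots> = \<i> * (v a * (\<Sum>c<n. cnj (v c) * A $$ (c, b)))"
    using assms by (simp add: sum_distrib_left mult.assoc)
  ultimately show "((\<lambda>t. (phase_mat n v t * A) $$ (a, b)) has_vector_derivative
     \<i> * (\<Sum>i<n. \<Sum>j<n. v i * cnj (v j) * ((if i = a then 1 else 0) * A $$ (j, b)))) (at 0)"
    by (simp add: phase_mat_mult_index[OF unitary_group_carrier[OF A(1)] assms])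
qed (use assms in \<open>auto intro!: bounded_measurable_entry bounded_measurable_mult bounded_measurable_const\<close>)

text \<open>Product rule: replacing factor number \<open>m\<close> of the power by
  \<open>E_ij A\<close> leaves \<open>A^m\<close> to the left of \<open>E_ij\<close> and, with the
  \<open>A\<close> it brings along, \<open>A^(k-m)\<close> to the right. So the left exponent can be
  0, the right one cannot.\<close>

lemma has_gradient_pow_entry:
  assumes "a < n" "b < n"
  shows "has_gradient n (\<lambda>A. (A ^\<^sub>m k) $$ (a, b)) (\<lambda>i j A. \<Sum>m<k. (A ^\<^sub>m m) $$ (a, i) * (A ^\<^sub>m (k - m)) $$ (j, b))"
  using assms(2)
proof (induction k arbitrary: b)
  case 0
  have "has_gradient n (\<lambda>A. (A ^\<^sub>m 0) $$ (a, b)) (\<lambda>i j A. 0) \<longleftrightarrow> has_gradient n (\<lambda>A. 1\<^sub>m n $$ (a, b)) (\<lambda>i j A. 0)"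
    by (rule has_gradient_cong) (auto dest!: unitary_group_carrier)
  then show ?case by (simp only: has_gradient_const lessThan_0 sum.empty)
next
  case (Suc k)
  have "has_gradient n (\<lambda>A. \<Sum>c<n. (A ^\<^sub>m k) $$ (a, c) * A $$ (c, b))
     (\<lambda>i j A. \<Sum>c<n. (A ^\<^sub>m k) $$ (a, c) * ((if i = c then 1 else 0) * A $$ (j, b)) +
        (\<Sum>m<k. (A ^\<^sub>m m) $$ (a, i) * (A ^\<^sub>m (k - m)) $$ (j, c)) * A $$ (c, b))"
    using Suc by (intro has_gradient_sum has_gradient_mult has_gradient_entry) auto
  moreover have "(\<Sum>m<Suc k. (A ^\<^sub>m m) $$ (a, i) * (A ^\<^sub>m (Suc k - m)) $$ (j, b))
     = (\<Sum>c<n. (A ^\<^sub>m k) $$ (a, c) * ((if i = c then 1 else 0) * A $$ (j, b)) +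
        (\<Sum>m<k. (A ^\<^sub>m m) $$ (a, i) * (A ^\<^sub>m (k - m)) $$ (j, c)) * A $$ (c, b))"
    if A: "A \<in> unitary_group n" "i < n" "j < n" for A i j
  proof -
    \<comment> \<open>Differentiating the last factor gives the new summand \<open>m = k\<close>;
      the exponent \<open>Suc k - k\<close> is kept in the shape of that summand.\<close>
    have "(\<Sum>c<n. (A ^\<^sub>m k) $$ (a, c) * ((if i = c then 1 else 0) * A $$ (j, b)))
        = (\<Sum>c<n. if c = i then (A ^\<^sub>m k) $$ (a, c) * A $$ (j, b) else 0)"
      by (rule sum.cong) auto
    also have "\<dots> = (A ^\<^sub>m k) $$ (a, i) * (A ^\<^sub>m (Suc k - k)) $$ (j, b)"
      using A unitary_group_carrier[OF A(1)] by simp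
    finally have 1: "(\<Sum>c<n. (A ^\<^sub>m k) $$ (a, c) * ((if i = c then 1 else 0) * A $$ (j, b)))
        = (A ^\<^sub>m k) $$ (a, i) * (A ^\<^sub>m (Suc k - k)) $$ (j, b)" .
    have "(\<Sum>c<n. (\<Sum>m<k. (A ^\<^sub>m m) $$ (a, i) * (A ^\<^sub>m (k - m)) $$ (j, c)) * A $$ (c, b))
       = (\<Sum>m<k. (A ^\<^sub>m m) $$ (a, i) * (\<Sum>c<n. (A ^\<^sub>m (k - m)) $$ (j, c) * A $$ (c, b)))"
      unfolding sum_distrib_left sum_distrib_right by (subst sum.swap) (simp add: mult_ac)
    also have "\<dots> = (\<Sum>m<k. (A ^\<^sub>m m) $$ (a, i) * (A ^\<^sub>m (Suc k - m)) $$ (j, b))"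
      using A Suc.prems by (intro sum.cong) (auto simp: pow_mat_Suc_index[symmetric] Suc_diff_le simp del: pow_mat.simps)
    finally show ?thesis
      unfolding sum.distrib 1 by simp
  qed
  ultimately show ?case
    using pow_mat_Suc_index[OF _ assms(1) Suc.prems] by (subst has_gradient_cong)
qed

section \<open>Polarization and integration by parts for Haar measure\<close>

text \<open>Complex polarization. Basis vectors kill the diagonal, and normalized sums of two basis
  vectors with a relative phase \<open>w\<close> kill the off-diagonal entries.\<close>

lemma quadratic_form_eq_0_imp:
  fixes c :: "nat \<Rightarrow> nat \<Rightarrow> complex"
  assumes Q: "\<And>v. unit_vector n v \<Longrightarrow> (\<Sum>i<n. \<Sum>j<n. v i * cnj (v j) * c i j) = 0"
    and ab: "a < n" "b < n"
  shows "c a b = 0"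
proof -
  have 2: "(\<Sum>i<n. f i) = f a + f b" if "a < n" "b < n" "a \<noteq> b" "\<And>i. i \<noteq> a \<Longrightarrow> i \<noteq> b \<Longrightarrow> f i = 0"
    for a b and f :: "nat \<Rightarrow> complex"
  proof -
    have "(\<Sum>i<n. f i) = (\<Sum>i\<in>{a, b}. f i)" using that by (intro sum.mono_neutral_right) auto
    then show ?thesis using that by simp
  qed
  have diag: "c a a = 0" if "a < n" for a
  proof -
    let ?v = "\<lambda>i. if i = a then 1 else 0 :: complex"
    have "unit_vector n ?v" using that by (simp add: unit_vector_def if_distrib[of cnj] if_distrib[of "\<lambda>x. _ * x"] cong: if_cong)
    from Q[OF this] have "(\<Sum>i<n. \<Sum>j<n. if i = a then (if j = a then c i j else 0) else 0) = 0"
      by (simp add: if_distrib[of cnj] if_distribR if_distrib[of "\<lambda>x. x * _"] cong: if_cong)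
    moreover have "(\<Sum>j<n. if i = a then (if j = a then c i j else 0) else 0) = (if i = a then c a a else 0)" for i
      using that by (cases "i = a") simp_all
    ultimately show ?thesis using that by simp
  qed
  show ?thesis
  proof (cases "a = b")
    case False
    have *: "cnj w * c a b + w * c b a = 0" if w: "w * cnj w = 1" for w
    proof -
      define s where "s = complex_of_real (1 / sqrt 2)"
      have s: "s * s = 1 / 2" "cnj s = s" by (simp_all add: s_def flip: of_real_mult)
      define v where "v = (\<lambda>i. if i = a then s else if i = b then s * w else 0)"
      have v: "v a = s" "v b = s * w" "\<And>i. i \<noteq> a \<Longrightarrow> i \<noteq> b \<Longrightarrow> v i = 0" using False by (auto simp: v_def)
      have "(\<Sum>i<n. v i * cnj (v i)) = s * s + (s * s) * (w * cnj w)"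
        by (subst 2[OF ab False]) (simp_all add: v s(2))
      also have "\<dots> = 1" unfolding s(1) w by simp
      finally have "unit_vector n v" by (simp add: unit_vector_def)
      from Q[OF this] have "v a * cnj (v a) * c a a + v a * cnj (v b) * c a b +
          (v b * cnj (v a) * c b a + v b * cnj (v b) * c b b) = 0"
        by (subst (asm) 2[OF ab False], simp add: v, subst (asm) (1 2) 2[OF ab False]) (simp_all add: v)
      then have "(s * s) * (cnj w * c a b + w * c b a) = 0"
        using diag ab by (simp add: v s(2) algebra_simps)
      then show ?thesis unfolding s(1) by simp
    qed
    \<comment> \<open>The phase 1 gives \<open>c a b + c b a = 0\<close>, and the phase
      \<open>\<i>\<close> gives \<open>c a b = c b a\<close>.\<close>
    from *[of 1] *[of \<i>] show ?thesis by (auto simp: complex_eq_iff)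
  qed (use diag ab in simp)
qed

lemma haar_integral_translate:
  assumes "unitary_haar n \<mu>" "V \<in> unitary_group n" "bounded_measurable n F"
  shows "(\<integral>A. F (V * A) \<partial>\<mu>) = (\<integral>A. F A \<partial>\<mu>)"
proof -
  have s: "sets \<mu> = sets (unitary_borel n)" using assms by (simp add: unitary_haar_def)
  have "(\<integral>A. F A \<partial>\<mu>) = (\<integral>A. F A \<partial>distr \<mu> \<mu> (\<lambda>A. V * A))"
    using assms by (simp add: unitary_haar_distr)
  also have "\<dots> = (\<integral>A. F (V * A) \<partial>\<mu>)"
    using assms(3) unitary_left_mult_measurable[OF assms(2)] s
    by (intro integral_distr) (auto simp: bounded_measurable_def cong: measurable_cong_sets)
  finally show ?thesis by simp
qed

text \<open>By invariance the mean of \<open>F\<close> along the flow of a unit vector is constant,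
  so the integrated gradient vanishes as a quadratic form in that vector. Polarization then gives
  every single entry, including directions that are not tangent to the group.\<close>

lemma haar_integral_gradient:
  assumes mu: "unitary_haar n \<mu>" and F: "has_gradient n F g" and ij: "i < n" "j < n"
  shows "(\<integral>A. g i j A \<partial>\<mu>) = 0"
proof (rule quadratic_form_eq_0_imp[OF _ ij])
  fix v assume v: "unit_vector n v"
  from mu interpret prob_space \<mu> by (simp add: unitary_haar_def)
  have s: "sets \<mu> = sets (unitary_borel n)" using mu by (simp add: unitary_haar_def)
  have sp: "space \<mu> = unitary_group n" by (rule space_unitary_haar[OF mu])
  define D where "D A = \<i> * (\<Sum>i<n. \<Sum>j<n. v i * cnj (v j) * g i j A)" for A
  have Fb: "bounded_measurable n F" and gb: "\<And>i j. i < n \<Longrightarrow> j < n \<Longrightarrow> bounded_measurable n (g i j)"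
    using F by (auto simp: has_gradient_def)
  have Db: "bounded_measurable n D"
    unfolding D_def using gb by (intro bounded_measurable_mult bounded_measurable_const bounded_measurable_sum) auto
  then obtain B where B: "\<And>A. A \<in> unitary_group n \<Longrightarrow> norm (D A) \<le> B"
    by (auto simp: bounded_measurable_def)
  note V = phase_mat_unitary[OF v]
  have tr: "(\<lambda>A. f (phase_mat n v t * A)) \<in> borel_measurable \<mu>" if "bounded_measurable n f" for f t
    using that measurable_compose[OF unitary_left_mult_measurable[OF V], of f borel] s
    by (simp add: bounded_measurable_def cong: measurable_cong_sets)
  \<comment> \<open>\<open>has_gradient\<close> speaks only of time 0. The group law of
    \<open>phase_mat\<close> moves the base point to carry this to time \<open>t\<close>.\<close>
  have der: "((\<lambda>s. F (phase_mat n v s * A)) has_vector_derivative D (phase_mat n v t * A)) (at t)"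
    if "A \<in> unitary_group n" for A t
  proof -
    have "((\<lambda>s. s - t) has_vector_derivative 1 - 0) (at t)"
      by (intro derivative_intros)
    moreover have "((\<lambda>s. F (phase_mat n v s * (phase_mat n v t * A))) has_vector_derivative D (phase_mat n v t * A)) (at (t - t))"
      using has_gradientD[OF F unitary_group_mult[OF V that] v] by (simp add: D_def)
    ultimately have "((\<lambda>s. F (phase_mat n v s * (phase_mat n v t * A))) \<circ> (\<lambda>s. s - t) has_vector_derivative
        (1 - 0) *\<^sub>R D (phase_mat n v t * A)) (at t)"
      by (rule vector_diff_chain_at)
    moreover have "phase_mat n v (s - t) * (phase_mat n v t * A) = phase_mat n v s * A" for s
      using unitary_group_carrier[OF that] v
      by (subst assoc_mult_mat[symmetric, of _ n n _ n _ n]) (simp_all add: phase_mat_mult)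
    ultimately show ?thesis by (simp add: comp_def)
  qed
  have "((\<lambda>t. \<integral>A. F (phase_mat n v t * A) \<partial>\<mu>) has_vector_derivative (\<integral>A. D (phase_mat n v 0 * A) \<partial>\<mu>)) (at 0)"
  proof (rule has_vector_derivative_lebesgue_integral)
    show "integrable \<mu> (\<lambda>A. F (phase_mat n v t * A))" for t
    proof -
      obtain C where "\<And>A. A \<in> unitary_group n \<Longrightarrow> norm (F A) \<le> C"
        using Fb by (auto simp: bounded_measurable_def)
      then show ?thesis
        using tr[OF Fb] unitary_group_mult[OF V]
        by (intro integrable_const_bound[where B = C]) (auto simp: sp)
    qed
    show "norm (D (phase_mat n v t * A)) \<le> B" if "A \<in> space \<mu>" for A t
      using that by (intro B unitary_group_mult V) (simp add: sp)
  qed (use tr[OF Db] der sp in \<open>auto intro: finite_measure_axioms\<close>)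
  then have "((\<lambda>t. \<integral>A. F A \<partial>\<mu>) has_vector_derivative (\<integral>A. D A \<partial>\<mu>)) (at (0 :: real))"
    by (simp only: haar_integral_translate[OF mu V Fb] haar_integral_translate[OF mu V Db])
  moreover have "((\<lambda>t. \<integral>A. F A \<partial>\<mu>) has_vector_derivative 0) (at (0 :: real))"
    by (rule has_vector_derivative_const)
  ultimately have "(\<integral>A. D A \<partial>\<mu>) = 0"
    by (rule vector_derivative_unique_at)
  moreover have "(\<integral>A. D A \<partial>\<mu>) = \<i> * (\<Sum>i<n. \<Sum>j<n. v i * cnj (v j) * (\<integral>A. g i j A \<partial>\<mu>))"
  proof -
    have gi: "integrable \<mu> (g i j)" if "i < n" "j < n" for i j
      by (rule bounded_measurable_integrable[OF mu gb[OF that]])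
    have "(\<integral>A. D A \<partial>\<mu>) = \<i> * (\<integral>A. (\<Sum>i<n. \<Sum>j<n. v i * cnj (v j) * g i j A) \<partial>\<mu>)"
      by (simp add: D_def)
    also have "(\<integral>A. (\<Sum>i<n. \<Sum>j<n. v i * cnj (v j) * g i j A) \<partial>\<mu>)
        = (\<Sum>i<n. \<integral>A. (\<Sum>j<n. v i * cnj (v j) * g i j A) \<partial>\<mu>)"
      using gi by (intro Bochner_Integration.integral_sum Bochner_Integration.integrable_sum integrable_mult_right) auto
    also have "\<dots> = (\<Sum>i<n. \<Sum>j<n. \<integral>A. v i * cnj (v j) * g i j A \<partial>\<mu>)"
      using gi by (intro sum.cong refl Bochner_Integration.integral_sum integrable_mult_right) auto
    finally show ?thesis by simp
  qed
  ultimately show "(\<Sum>i<n. \<Sum>j<n. v i * cnj (v j) * (\<integral>A. g i j A \<partial>\<mu>)) = 0"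
    by simp
qed

section \<open>Traces of powers\<close>

definition pow_trace :: "nat \<Rightarrow> complex mat \<Rightarrow> complex" where
  "pow_trace k A = mat_trace (A ^\<^sub>m k)"

lemma pow_trace_sum: "A \<in> unitary_group n \<Longrightarrow> pow_trace k A = (\<Sum>a<n. (A ^\<^sub>m k) $$ (a, a))"
  using unitary_group_carrier[of A n] by (simp add: pow_trace_def mat_trace_def)

lemma pow_trace_0: "A \<in> unitary_group n \<Longrightarrow> pow_trace 0 A = of_nat n"
  using unitary_group_carrier[of A n] by (simp add: pow_trace_sum)

lemma norm_pow_trace_le:
  assumes "A \<in> unitary_group n"
  shows "norm (pow_trace k A) \<le> n"
proof -
  have "norm (\<Sum>a<n. (A ^\<^sub>m k) $$ (a, a)) \<le> of_nat (card {..<n}) * 1"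
    using unitary_group_entry_le_1[OF unitary_group_pow[OF assms]] by (intro sum_norm_bound) auto
  then show ?thesis by (simp add: pow_trace_sum[OF assms])
qed

lemma bounded_measurable_pow_trace: "bounded_measurable n (pow_trace k)"
proof -
  have "bounded_measurable n (\<lambda>A. \<Sum>a<n. (A ^\<^sub>m k) $$ (a, a))"
    by (intro bounded_measurable_sum bounded_measurable_pow_entry) auto
  then show ?thesis by (subst bounded_measurable_cong[OF pow_trace_sum])
qed

lemma pow_mat_add_index:
  assumes "A \<in> unitary_group n" "a < n" "b < n"
  shows "(\<Sum>c<n. (A ^\<^sub>m p) $$ (a, c) * (A ^\<^sub>m q) $$ (c, b)) = (A ^\<^sub>m (p + q)) $$ (a, b)"
  using assms index_mult_mat_sum[of "A ^\<^sub>m p" n n "A ^\<^sub>m q" n a b]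
  by (simp add: unitary_group_carrier unitary_group_pow pow_mat_add[OF unitary_group_carrier[OF assms(1)]])

text \<open>By cyclicity of the trace all \<open>k\<close> terms of the product rule coincide. This
  factor \<open>k\<close> becomes the variance of the limit.\<close>

lemma has_gradient_pow_trace:
  "has_gradient n (pow_trace k) (\<lambda>i j A. of_nat k * (A ^\<^sub>m k) $$ (j, i))"
proof -
  have g: "has_gradient n (\<lambda>A. \<Sum>a<n. (A ^\<^sub>m k) $$ (a, a))
     (\<lambda>i j A. \<Sum>a<n. \<Sum>m<k. (A ^\<^sub>m m) $$ (a, i) * (A ^\<^sub>m (k - m)) $$ (j, a))"
    by (intro has_gradient_sum has_gradient_pow_entry) auto
  have eq: "of_nat k * (A ^\<^sub>m k) $$ (j, i) = (\<Sum>a<n. \<Sum>m<k. (A ^\<^sub>m m) $$ (a, i) * (A ^\<^sub>m (k - m)) $$ (j, a))"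
    if "A \<in> unitary_group n" "i < n" "j < n" for A i j
  proof -
    have "(\<Sum>a<n. \<Sum>m<k. (A ^\<^sub>m m) $$ (a, i) * (A ^\<^sub>m (k - m)) $$ (j, a))
        = (\<Sum>m<k. \<Sum>a<n. (A ^\<^sub>m (k - m)) $$ (j, a) * (A ^\<^sub>m m) $$ (a, i))"
      by (subst sum.swap) (simp add: mult.commute)
    also have "\<dots> = (\<Sum>m<k. (A ^\<^sub>m k) $$ (j, i))"
      using that by (intro sum.cong) (auto simp: pow_mat_add_index)
    finally show ?thesis by simp
  qed
  show ?thesis
    using g by (subst has_gradient_cong[OF pow_trace_sum eq])
qed

lemma sum_pow_entries_mult:
  assumes "A \<in> unitary_group n"
  shows "(\<Sum>a<n. \<Sum>b<n. (A ^\<^sub>m k) $$ (a, b) * (A ^\<^sub>m j) $$ (b, a)) = pow_trace (k + j) A"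
  using assms by (simp add: pow_mat_add_index pow_trace_sum)

text \<open>The sum is the trace of \<open>A^k\<close> times the adjoint of \<open>A^j\<close>, and
  by unitarity the common power cancels. For \<open>j = k\<close> the trace of the identity remains,
  the one case of order \<open>n\<close>.\<close>

lemma sum_pow_entries_cnj:
  assumes "A \<in> unitary_group n"
  shows "(\<Sum>a<n. \<Sum>b<n. (A ^\<^sub>m k) $$ (a, b) * cnj ((A ^\<^sub>m j) $$ (a, b))) =
    (if j \<le> k then pow_trace (k - j) A else cnj (pow_trace (j - k) A))"
proof -
  have *: "(\<Sum>a<n. \<Sum>b<n. (A ^\<^sub>m k) $$ (a, b) * cnj ((A ^\<^sub>m j) $$ (a, b))) = pow_trace (k - j) A"
    if "j \<le> k" for j k
  proof -
    have "(\<Sum>a<n. \<Sum>b<n. (A ^\<^sub>m k) $$ (a, b) * cnj ((A ^\<^sub>m j) $$ (a, b)))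
       = (\<Sum>a<n. \<Sum>b<n. (\<Sum>c<n. (A ^\<^sub>m (k - j)) $$ (a, c) * (A ^\<^sub>m j) $$ (c, b)) * cnj ((A ^\<^sub>m j) $$ (a, b)))"
      using that assms by (simp add: pow_mat_add_index)
    also have "\<dots> = (\<Sum>a<n. \<Sum>c<n. (A ^\<^sub>m (k - j)) $$ (a, c) * (\<Sum>b<n. (A ^\<^sub>m j) $$ (c, b) * cnj ((A ^\<^sub>m j) $$ (a, b))))"
      unfolding sum_distrib_left sum_distrib_right
      by (rule sum.cong[OF refl], subst sum.swap) (simp add: mult_ac)
    also have "\<dots> = (\<Sum>a<n. \<Sum>c<n. if c = a then (A ^\<^sub>m (k - j)) $$ (a, c) else 0)"
      by (intro sum.cong refl) (simp add: unitary_group_rows[OF unitary_group_pow[OF assms]])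
    also have "\<dots> = pow_trace (k - j) A" by (simp add: pow_trace_sum[OF assms])
    finally show ?thesis .
  qed
  show ?thesis
  proof (cases "j \<le> k")
    case False
    have "(\<Sum>a<n. \<Sum>b<n. (A ^\<^sub>m k) $$ (a, b) * cnj ((A ^\<^sub>m j) $$ (a, b)))
       = cnj (\<Sum>a<n. \<Sum>b<n. (A ^\<^sub>m j) $$ (a, b) * cnj ((A ^\<^sub>m k) $$ (a, b)))"
      by (simp add: mult.commute)
    with False show ?thesis by (simp only: * if_False)
  qed (simp add: *)
qed

text \<open>Integration by parts for \<open>(A\<^sup>k)\<^sub>a\<^sub>b G\<close> in the direction \<open>E\<^sub>a\<^sub>b\<close>, summed over \<open>a\<close> and \<open>b\<close>.\<close>

lemma loop_equation:
  assumes mu: "unitary_haar n \<mu>" and G: "has_gradient n G \<gamma>" and k: "k \<ge> 1"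
  shows "(\<integral>A. (of_nat n * pow_trace k A + (\<Sum>m\<in>{1..<k}. pow_trace m A * pow_trace (k - m) A)) * G A +
     (\<Sum>a<n. \<Sum>b<n. (A ^\<^sub>m k) $$ (a, b) * \<gamma> a b A) \<partial>\<mu>) = 0"
proof -
  have sp: "space \<mu> = unitary_group n" by (rule space_unitary_haar[OF mu])
  define g where "g a b A = (A ^\<^sub>m k) $$ (a, b) * \<gamma> a b A +
      (\<Sum>m<k. (A ^\<^sub>m m) $$ (a, a) * (A ^\<^sub>m (k - m)) $$ (b, b)) * G A" for a b A
  have g0: "(\<integral>A. g a b A \<partial>\<mu>) = 0" if "a < n" "b < n" for a b
    unfolding g_def
    by (rule haar_integral_gradient[OF mu has_gradient_mult[OF has_gradient_pow_entry[OF that] G] that])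
  have gi: "integrable \<mu> (g a b)" if "a < n" "b < n" for a b
    using that G unfolding g_def
    by (intro bounded_measurable_integrable[OF mu] bounded_measurable_add bounded_measurable_mult
         bounded_measurable_sum bounded_measurable_pow_entry) (auto simp: has_gradient_def)
  have eq: "(of_nat n * pow_trace k A + (\<Sum>m\<in>{1..<k}. pow_trace m A * pow_trace (k - m) A)) * G A +
     (\<Sum>a<n. \<Sum>b<n. (A ^\<^sub>m k) $$ (a, b) * \<gamma> a b A) = (\<Sum>a<n. \<Sum>b<n. g a b A)" if "A \<in> space \<mu>" for A
  proof -
    have A: "A \<in> unitary_group n" using that sp by simp
    have "(\<Sum>a<n. \<Sum>b<n. (\<Sum>m<k. (A ^\<^sub>m m) $$ (a, a) * (A ^\<^sub>m (k - m)) $$ (b, b)))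
        = (\<Sum>a<n. \<Sum>m<k. \<Sum>b<n. (A ^\<^sub>m m) $$ (a, a) * (A ^\<^sub>m (k - m)) $$ (b, b))"
      by (rule sum.cong[OF refl], rule sum.swap)
    also have "\<dots> = (\<Sum>m<k. \<Sum>a<n. \<Sum>b<n. (A ^\<^sub>m m) $$ (a, a) * (A ^\<^sub>m (k - m)) $$ (b, b))"
      by (rule sum.swap)
    also have "\<dots> = (\<Sum>m<k. pow_trace m A * pow_trace (k - m) A)"
      by (simp add: pow_trace_sum[OF A] sum_product)
    \<comment> \<open>The term \<open>m = 0\<close> carries the trace of the identity and is the
      leading one.\<close>
    also have "\<dots> = (\<Sum>m\<in>insert 0 {1..<k}. pow_trace m A * pow_trace (k - m) A)"
      using k by (intro sum.cong) auto
    also have "(\<Sum>m\<in>insert 0 {1..<k}. pow_trace m A * pow_trace (k - m) A) =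
        of_nat n * pow_trace k A + (\<Sum>m\<in>{1..<k}. pow_trace m A * pow_trace (k - m) A)"
      by (subst sum.insert) (auto simp: pow_trace_0[OF A])
    finally have *: "(\<Sum>a<n. \<Sum>b<n. (\<Sum>m<k. (A ^\<^sub>m m) $$ (a, a) * (A ^\<^sub>m (k - m)) $$ (b, b)))
        = of_nat n * pow_trace k A + (\<Sum>m\<in>{1..<k}. pow_trace m A * pow_trace (k - m) A)" .
    have "(\<Sum>a<n. \<Sum>b<n. g a b A) = (\<Sum>a<n. \<Sum>b<n. (A ^\<^sub>m k) $$ (a, b) * \<gamma> a b A) +
       (\<Sum>a<n. \<Sum>b<n. (\<Sum>m<k. (A ^\<^sub>m m) $$ (a, a) * (A ^\<^sub>m (k - m)) $$ (b, b))) * G A"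
      unfolding g_def sum.distrib sum_distrib_right ..
    then show ?thesis unfolding * by simp
  qed
  have "(\<integral>A. (\<Sum>a<n. \<Sum>b<n. g a b A) \<partial>\<mu>) = (\<Sum>a<n. \<integral>A. (\<Sum>b<n. g a b A) \<partial>\<mu>)"
    using gi by (intro Bochner_Integration.integral_sum Bochner_Integration.integrable_sum) auto
  also have "\<dots> = (\<Sum>a<n. \<Sum>b<n. \<integral>A. g a b A \<partial>\<mu>)"
    using gi by (intro sum.cong refl Bochner_Integration.integral_sum) auto
  finally show ?thesis
    using g0 by (subst Bochner_Integration.integral_cong[OF refl eq]) simp_all
qed

section \<open>Second moments of the traces, uniformly in the dimension\<close>

lemma pow_trace_square_integrable:
  assumes "unitary_haar n \<mu>"
  shows "integrable \<mu> (\<lambda>A. (norm (pow_trace k A))\<^sup>2)"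
proof -
  have "integrable \<mu> (\<lambda>A. norm (pow_trace k A * pow_trace k A))"
    by (intro integrable_norm bounded_measurable_integrable[OF assms] bounded_measurable_mult bounded_measurable_pow_trace)
  then show ?thesis
    by (simp add: norm_mult power2_eq_square)
qed

text \<open>In the loop equation for \<open>G = cnj (pow_trace k A)\<close> one of the three traces in each cubic term is
  bounded by \<open>n\<close>; AM-GM with weight \<open>k\<close> absorbs the rest into half of the leading term.\<close>

lemma pow_trace_second_moment_step:
  assumes mu: "unitary_haar n \<mu>" and n: "n \<ge> 1" and k: "k \<ge> 1"
    and C: "\<And>m. m \<in> {1..<k} \<Longrightarrow> (\<integral>A. (norm (pow_trace m A))\<^sup>2 \<partial>\<mu>) \<le> C m"
  shows "(\<integral>A. (norm (pow_trace k A))\<^sup>2 \<partial>\<mu>) \<le> 2 * k + k * (\<Sum>m\<in>{1..<k}. C m)"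
proof -
  from mu interpret prob_space \<mu> by (simp add: unitary_haar_def)
  have sp: "space \<mu> = unitary_group n" by (rule space_unitary_haar[OF mu])
  note int = pow_trace_square_integrable[OF mu]
  \<comment> \<open>The integrand of the loop equation with its gradient term already evaluated:
    \<open>k\<close> times the trace of the identity, with a minus sign.\<close>
  define h where "h A = (of_nat n * pow_trace k A + (\<Sum>m\<in>{1..<k}. pow_trace m A * pow_trace (k - m) A)) * cnj (pow_trace k A)
      - of_nat k * of_nat n" for A
  have hb: "bounded_measurable n h"
    unfolding h_def diff_conv_add_uminus
    by (intro bounded_measurable_add bounded_measurable_mult bounded_measurable_cnj bounded_measurable_sum
        bounded_measurable_pow_trace bounded_measurable_const)
  have "(\<integral>A. h A \<partial>\<mu>) = 0"
  proof -
    have "h A = (of_nat n * pow_trace k A + (\<Sum>m\<in>{1..<k}. pow_trace m A * pow_trace (k - m) A)) * cnj (pow_trace k A) +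
     (\<Sum>a<n. \<Sum>b<n. (A ^\<^sub>m k) $$ (a, b) * - cnj (of_nat k * (A ^\<^sub>m k) $$ (a, b)))" if "A \<in> space \<mu>" for A
    proof -
      have A: "A \<in> unitary_group n" using that sp by simp
      have "(\<Sum>a<n. \<Sum>b<n. (A ^\<^sub>m k) $$ (a, b) * - cnj (of_nat k * (A ^\<^sub>m k) $$ (a, b)))
         = - (of_nat k * (\<Sum>a<n. \<Sum>b<n. (A ^\<^sub>m k) $$ (a, b) * cnj ((A ^\<^sub>m k) $$ (a, b))))"
        by (simp add: sum_distrib_left sum_negf mult_ac)
      then show ?thesis by (simp only: sum_pow_entries_cnj[OF A] h_def) (simp add: pow_trace_0[OF A])
    qed
    then show ?thesis
      using loop_equation[OF mu has_gradient_cnj[OF has_gradient_pow_trace] k]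
      by (subst Bochner_Integration.integral_cong[OF refl]) auto
  qed
  then have h0: "(\<integral>A. Re (h A) \<partial>\<mu>) = 0"
    using bounded_measurable_integrable[OF mu hb] by simp
  have ge: "n * ((norm (pow_trace k A))\<^sup>2 / 2 - k / 2 * (\<Sum>m\<in>{1..<k}. (norm (pow_trace m A))\<^sup>2) - k) \<le> Re (h A)"
    if "A \<in> space \<mu>" for A
  proof -
    have A: "A \<in> unitary_group n" using that sp by simp
    let ?p = "\<lambda>m. norm (pow_trace m A)"
    have "norm ((\<Sum>m\<in>{1..<k}. pow_trace m A * pow_trace (k - m) A) * cnj (pow_trace k A))
        \<le> (\<Sum>m\<in>{1..<k}. ?p m * ?p (k - m)) * ?p k"
      unfolding norm_mult complex_mod_cnj
      by (intro mult_right_mono order_trans[OF norm_sum]) (auto simp: norm_mult)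
    also have "\<dots> \<le> (\<Sum>m\<in>{1..<k}. n * (k / 2 * (?p m)\<^sup>2 + (?p k)\<^sup>2 / (2 * k)))"
      unfolding sum_distrib_right
    proof (rule sum_mono)
      fix m
      have "0 \<le> (k * ?p m - ?p k)\<^sup>2 / (2 * k)" by simp
      also have "\<dots> = k / 2 * (?p m)\<^sup>2 + (?p k)\<^sup>2 / (2 * k) - ?p m * ?p k"
        using k by (simp add: power2_eq_square field_simps)
      finally have 1: "?p m * ?p k \<le> k / 2 * (?p m)\<^sup>2 + (?p k)\<^sup>2 / (2 * k)" by simp
      have "?p m * ?p (k - m) * ?p k = ?p (k - m) * (?p m * ?p k)" by simp
      also have "\<dots> \<le> n * (?p m * ?p k)"
        by (intro mult_right_mono norm_pow_trace_le[OF A]) simp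
      also have "\<dots> \<le> n * (k / 2 * (?p m)\<^sup>2 + (?p k)\<^sup>2 / (2 * k))"
        by (intro mult_left_mono 1) simp
      finally show "?p m * ?p (k - m) * ?p k \<le> n * (k / 2 * (?p m)\<^sup>2 + (?p k)\<^sup>2 / (2 * k))" .
    qed
    also have "\<dots> = n * (k / 2 * (\<Sum>m\<in>{1..<k}. (?p m)\<^sup>2) + (k - 1) * ((?p k)\<^sup>2 / (2 * k)))"
      using k by (simp add: sum_distrib_left sum.distrib distrib_left of_nat_diff algebra_simps)
    \<comment> \<open>The \<open>k - 1\<close> copies of \<open>1 / (2 * k)\<close> add up to at
      most one half; the weight in AM-GM was chosen for this.\<close>
    also have "\<dots> \<le> n * (k / 2 * (\<Sum>m\<in>{1..<k}. (?p m)\<^sup>2) + (?p k)\<^sup>2 / 2)"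
      using k by (intro mult_left_mono add_left_mono) (auto simp: field_simps)
    finally have "- Re ((\<Sum>m\<in>{1..<k}. pow_trace m A * pow_trace (k - m) A) * cnj (pow_trace k A))
        \<le> n * (k / 2 * (\<Sum>m\<in>{1..<k}. (?p m)\<^sup>2) + (?p k)\<^sup>2 / 2)"
      using abs_Re_le_cmod[of "(\<Sum>m\<in>{1..<k}. pow_trace m A * pow_trace (k - m) A) * cnj (pow_trace k A)"]
      by linarith
    moreover have "Re (h A) = n * (?p k)\<^sup>2 + Re ((\<Sum>m\<in>{1..<k}. pow_trace m A * pow_trace (k - m) A) * cnj (pow_trace k A)) - k * n"
    proof -
      have "h A = complex_of_real (n * (?p k)\<^sup>2) + (\<Sum>m\<in>{1..<k}. pow_trace m A * pow_trace (k - m) A) * cnj (pow_trace k A)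
          - complex_of_real (k * n)"
        unfolding h_def of_real_mult complex_norm_square by (simp add: algebra_simps)
      then show ?thesis by (simp only: minus_complex.sel plus_complex.sel Re_complex_of_real)
    qed
    ultimately show ?thesis by (simp add: algebra_simps)
  qed
  have "n * ((\<integral>A. (norm (pow_trace k A))\<^sup>2 \<partial>\<mu>) / 2 - k / 2 * (\<Sum>m\<in>{1..<k}. (\<integral>A. (norm (pow_trace m A))\<^sup>2 \<partial>\<mu>)) - k)
      = (\<integral>A. n * ((norm (pow_trace k A))\<^sup>2 / 2 - k / 2 * (\<Sum>m\<in>{1..<k}. (norm (pow_trace m A))\<^sup>2) - k) \<partial>\<mu>)"
    using int by (simp add: prob_space)
  also have "\<dots> \<le> (\<integral>A. Re (h A) \<partial>\<mu>)"
    using int bounded_measurable_integrable[OF mu hb] ge by (intro integral_mono) auto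
  finally have "(\<integral>A. (norm (pow_trace k A))\<^sup>2 \<partial>\<mu>) / 2 - k / 2 * (\<Sum>m\<in>{1..<k}. (\<integral>A. (norm (pow_trace m A))\<^sup>2 \<partial>\<mu>)) - k \<le> 0"
    using n h0 by (simp add: mult_le_0_iff)
  moreover have "k / 2 * (\<Sum>m\<in>{1..<k}. (\<integral>A. (norm (pow_trace m A))\<^sup>2 \<partial>\<mu>)) \<le> k / 2 * (\<Sum>m\<in>{1..<k}. C m)"
    using C by (intro mult_left_mono sum_mono) auto
  ultimately show ?thesis by simp
qed

text \<open>The recursion for the bound does not involve \<open>n\<close> or the measure, so strong
  induction yields a constant chosen before both.\<close>

lemma pow_trace_second_moment_bounded:
  "\<exists>C::real. \<forall>n \<mu>. n \<ge> 1 \<longrightarrow> unitary_haar n \<mu> \<longrightarrow> (\<integral>A. (norm (pow_trace k A))\<^sup>2 \<partial>\<mu>) \<le> C"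
  if "k \<ge> 1"
  using that
proof (induction k rule: less_induct)
  case (less k)
  then have "\<forall>m\<in>{1..<k}. \<exists>C::real. \<forall>n \<mu>. n \<ge> 1 \<longrightarrow> unitary_haar n \<mu> \<longrightarrow> (\<integral>A. (norm (pow_trace m A))\<^sup>2 \<partial>\<mu>) \<le> C"
    by auto
  from bchoice[OF this] obtain C :: "nat \<Rightarrow> real" where "\<And>m n \<mu>. m \<in> {1..<k} \<Longrightarrow> n \<ge> 1 \<Longrightarrow> unitary_haar n \<mu> \<Longrightarrow>
      (\<integral>A. (norm (pow_trace m A))\<^sup>2 \<partial>\<mu>) \<le> C m"
    by blast
  then have "\<forall>n \<mu>. n \<ge> 1 \<longrightarrow> unitary_haar n \<mu> \<longrightarrow>
      (\<integral>A. (norm (pow_trace k A))\<^sup>2 \<partial>\<mu>) \<le> 2 * k + k * (\<Sum>m\<in>{1..<k}. C m)"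
    using pow_trace_second_moment_step less.prems by (intro allI impI) (simp only: of_nat_mult of_nat_numeral)
  then show ?case by blast
qed

section \<open>Characteristic function of the vector of traces\<close>

definition trace_form :: "nat set \<Rightarrow> (nat \<Rightarrow> complex) \<Rightarrow> complex mat \<Rightarrow> real" where
  "trace_form I \<xi> A = (\<Sum>j\<in>I. Re (cnj (\<xi> j) * pow_trace j A))"

text \<open>The trace of \<open>A\<^sup>k (A\<^sup>*)\<^sup>j\<close> for unitary \<open>A\<close>.\<close>

definition adjoint_pow_trace :: "nat \<Rightarrow> nat \<Rightarrow> complex mat \<Rightarrow> complex" where
  "adjoint_pow_trace k j A = (if j \<le> k then pow_trace (k - j) A else cnj (pow_trace (j - k) A))"

lemma bounded_measurable_adjoint_pow_trace: "bounded_measurable n (adjoint_pow_trace k j)"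
  unfolding adjoint_pow_trace_def
  by (cases "j \<le> k") (simp_all add: bounded_measurable_pow_trace bounded_measurable_cnj)

text \<open>Real parts are rewritten through traces and their conjugates, so that the gradient rules
  for sums, conjugates and exponentials apply.\<close>

lemma cis_trace_form:
  "cis (s * trace_form I \<xi> A) =
     exp (\<Sum>j\<in>I. \<i> * s / 2 * (cnj (\<xi> j) * pow_trace j A + \<xi> j * cnj (pow_trace j A)))"
proof -
  have "cnj z * w + z * cnj w = complex_of_real (2 * Re (cnj z * w))" for z w
    by (simp add: complex_eq_iff)
  moreover have halve: "c / 2 * complex_of_real (2 * r) = c * complex_of_real r" for c r
    by simp
  ultimately have "(\<Sum>j\<in>I. \<i> * s / 2 * (cnj (\<xi> j) * pow_trace j A + \<xi> j * cnj (pow_trace j A)))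
     = (\<Sum>j\<in>I. \<i> * s * complex_of_real (Re (cnj (\<xi> j) * pow_trace j A)))"
    by (simp only: halve)
  also have "\<dots> = \<i> * complex_of_real (s * trace_form I \<xi> A)"
    unfolding trace_form_def of_real_mult of_real_sum sum_distrib_left by (simp only: mult.assoc)
  finally show ?thesis by (simp only: cis_conv_exp)
qed

lemma has_gradient_cis_trace_form:
  "has_gradient n (\<lambda>A. cis (s * trace_form I \<xi> A))
     (\<lambda>a b A. cis (s * trace_form I \<xi> A) * (\<Sum>j\<in>I. \<i> * s / 2 *
        (cnj (\<xi> j) * (of_nat j * (A ^\<^sub>m j) $$ (b, a)) + \<xi> j * - cnj (of_nat j * (A ^\<^sub>m j) $$ (a, b)))))"
  unfolding cis_trace_form
  by (intro has_gradient_exp has_gradient_sum has_gradient_cmult has_gradient_add has_gradient_cnj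
      has_gradient_pow_trace)

text \<open>All terms of the loop equation that lack a factor \<open>n\<close>: splittings of the
  power, pairings of \<open>A^k\<close> with \<open>A^j\<close>, and pairings of \<open>A^k\<close>
  with the adjoint of \<open>A^j\<close> for \<open>j\<close> different from
  \<open>k\<close>.\<close>

definition loop_remainder :: "nat set \<Rightarrow> (nat \<Rightarrow> complex) \<Rightarrow> real \<Rightarrow> nat \<Rightarrow> complex mat \<Rightarrow> complex" where
  "loop_remainder I \<xi> s k A = (\<Sum>m\<in>{1..<k}. pow_trace m A * pow_trace (k - m) A) +
     (\<Sum>j\<in>I. \<i> * s / 2 * (of_nat j * cnj (\<xi> j) * pow_trace (k + j) A)) +
     (\<Sum>j\<in>I - {k}. (- \<i>) * s / 2 * (of_nat j * \<xi> j * adjoint_pow_trace k j A))"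

lemma bounded_measurable_cis_trace_form: "bounded_measurable n (\<lambda>A. cis (s * trace_form I \<xi> A))"
  using has_gradient_cis_trace_form by (auto simp: has_gradient_def)

lemma bounded_measurable_loop_remainder: "bounded_measurable n (loop_remainder I \<xi> s k)"
  unfolding loop_remainder_def
  by (intro bounded_measurable_add bounded_measurable_sum bounded_measurable_mult bounded_measurable_const
      bounded_measurable_pow_trace bounded_measurable_adjoint_pow_trace)

text \<open>The gradient of the character pairs \<open>A^k\<close> with every \<open>A^j\<close> and
  its adjoint. Only the adjoint with \<open>j = k\<close> yields the trace of the identity; it joins
  the leading term, and dividing by \<open>n\<close> will leave \<open>\<xi> k\<close> as the only
  frequency in the main term.\<close>

lemma characteristic_loop_equation:
  fixes s :: real and \<xi> :: "nat \<Rightarrow> complex"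
  assumes mu: "unitary_haar n \<mu>" and I: "finite I" "k \<in> I" and k: "k \<ge> 1"
  defines "G \<equiv> \<lambda>A. cis (s * trace_form I \<xi> A)"
  shows "of_nat n * ((\<integral>A. pow_trace k A * G A \<partial>\<mu>) - \<i> * s / 2 * of_nat k * \<xi> k * (\<integral>A. G A \<partial>\<mu>)) =
    - (\<integral>A. loop_remainder I \<xi> s k A * G A \<partial>\<mu>)"
proof -
  note Gb = bounded_measurable_cis_trace_form[of n s I \<xi>, folded G_def]
  have eq: "(of_nat n * pow_trace k A + (\<Sum>m\<in>{1..<k}. pow_trace m A * pow_trace (k - m) A)) * G A +
     (\<Sum>a<n. \<Sum>b<n. (A ^\<^sub>m k) $$ (a, b) * (G A * (\<Sum>j\<in>I. \<i> * s / 2 *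
        (cnj (\<xi> j) * (of_nat j * (A ^\<^sub>m j) $$ (b, a)) + \<xi> j * - cnj (of_nat j * (A ^\<^sub>m j) $$ (a, b))))))
     = of_nat n * (pow_trace k A * G A) + (- (of_nat n * (\<i> * s / 2 * of_nat k * \<xi> k))) * G A + loop_remainder I \<xi> s k A * G A"
    if "A \<in> space \<mu>" for A
  proof -
    have A: "A \<in> unitary_group n" using that space_unitary_haar[OF mu] by simp
    have "(\<Sum>a<n. \<Sum>b<n. (A ^\<^sub>m k) $$ (a, b) * (\<Sum>j\<in>I. \<i> * s / 2 *
        (cnj (\<xi> j) * (of_nat j * (A ^\<^sub>m j) $$ (b, a)) + \<xi> j * - cnj (of_nat j * (A ^\<^sub>m j) $$ (a, b)))))
      = (\<Sum>a<n. \<Sum>j\<in>I. \<Sum>b<n. (A ^\<^sub>m k) $$ (a, b) * (\<i> * s / 2 *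
        (cnj (\<xi> j) * (of_nat j * (A ^\<^sub>m j) $$ (b, a)) + \<xi> j * - cnj (of_nat j * (A ^\<^sub>m j) $$ (a, b)))))"
      unfolding sum_distrib_left by (rule sum.cong[OF refl], rule sum.swap)
    also have "\<dots> = (\<Sum>j\<in>I. \<Sum>a<n. \<Sum>b<n. (A ^\<^sub>m k) $$ (a, b) * (\<i> * s / 2 *
        (cnj (\<xi> j) * (of_nat j * (A ^\<^sub>m j) $$ (b, a)) + \<xi> j * - cnj (of_nat j * (A ^\<^sub>m j) $$ (a, b)))))"
      by (rule sum.swap)
    also have "\<dots> = (\<Sum>j\<in>I. \<i> * s / 2 * (of_nat j * cnj (\<xi> j) * (\<Sum>a<n. \<Sum>b<n. (A ^\<^sub>m k) $$ (a, b) * (A ^\<^sub>m j) $$ (b, a))) +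
        (- \<i>) * s / 2 * (of_nat j * \<xi> j * (\<Sum>a<n. \<Sum>b<n. (A ^\<^sub>m k) $$ (a, b) * cnj ((A ^\<^sub>m j) $$ (a, b)))))"
      unfolding sum_distrib_left sum.distrib[symmetric] by (intro sum.cong refl) (simp add: algebra_simps)
    also have "\<dots> = (\<Sum>j\<in>I. \<i> * s / 2 * (of_nat j * cnj (\<xi> j) * pow_trace (k + j) A)) +
        (\<Sum>j\<in>I. (- \<i>) * s / 2 * (of_nat j * \<xi> j * adjoint_pow_trace k j A))"
      unfolding sum_pow_entries_mult[OF A] sum_pow_entries_cnj[OF A] adjoint_pow_trace_def[symmetric] sum.distrib ..
    also have "(\<Sum>j\<in>I. (- \<i>) * s / 2 * (of_nat j * \<xi> j * adjoint_pow_trace k j A)) =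
       (- \<i>) * s / 2 * (of_nat k * \<xi> k * of_nat n) + (\<Sum>j\<in>I - {k}. (- \<i>) * s / 2 * (of_nat j * \<xi> j * adjoint_pow_trace k j A))"
      using I by (subst sum.remove[of I k]) (auto simp: adjoint_pow_trace_def pow_trace_0[OF A])
    finally have *: "(\<Sum>a<n. \<Sum>b<n. (A ^\<^sub>m k) $$ (a, b) * (\<Sum>j\<in>I. \<i> * s / 2 *
        (cnj (\<xi> j) * (of_nat j * (A ^\<^sub>m j) $$ (b, a)) + \<xi> j * - cnj (of_nat j * (A ^\<^sub>m j) $$ (a, b)))))
      = (\<Sum>j\<in>I. \<i> * s / 2 * (of_nat j * cnj (\<xi> j) * pow_trace (k + j) A)) +
        ((- \<i>) * s / 2 * (of_nat k * \<xi> k * of_nat n) + (\<Sum>j\<in>I - {k}. (- \<i>) * s / 2 * (of_nat j * \<xi> j * adjoint_pow_trace k j A)))" .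
    have pull: "(\<Sum>a<n. \<Sum>b<n. (A ^\<^sub>m k) $$ (a, b) * (G A * f a b)) = G A * (\<Sum>a<n. \<Sum>b<n. (A ^\<^sub>m k) $$ (a, b) * f a b)" for f
      by (simp add: sum_distrib_left mult_ac)
    show ?thesis
      unfolding pull * loop_remainder_def by (simp add: algebra_simps)
  qed
  have "(\<integral>A. of_nat n * (pow_trace k A * G A) + (- (of_nat n * (\<i> * s / 2 * of_nat k * \<xi> k))) * G A +
     loop_remainder I \<xi> s k A * G A \<partial>\<mu>) = 0"
    by (subst Bochner_Integration.integral_cong[OF refl eq, symmetric], assumption, unfold G_def)
      (rule loop_equation[OF mu has_gradient_cis_trace_form k])
  moreover have "(\<integral>A. of_nat n * (pow_trace k A * G A) + (- (of_nat n * (\<i> * s / 2 * of_nat k * \<xi> k))) * G A +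
     loop_remainder I \<xi> s k A * G A \<partial>\<mu>) = of_nat n * (\<integral>A. pow_trace k A * G A \<partial>\<mu>) + (- (of_nat n * (\<i> * s / 2 * of_nat k * \<xi> k))) * (\<integral>A. G A \<partial>\<mu>) +
     (\<integral>A. loop_remainder I \<xi> s k A * G A \<partial>\<mu>)"
  proof -
    have 1: "integrable \<mu> (\<lambda>A. pow_trace k A * G A)"
      by (intro bounded_measurable_integrable[OF mu] bounded_measurable_mult bounded_measurable_pow_trace Gb)
    have 2: "integrable \<mu> G" by (rule bounded_measurable_integrable[OF mu Gb])
    have 3: "integrable \<mu> (\<lambda>A. loop_remainder I \<xi> s k A * G A)"
      by (intro bounded_measurable_integrable[OF mu] bounded_measurable_mult bounded_measurable_loop_remainder Gb)
    show ?thesis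
      by (simp only: Bochner_Integration.integral_add integrable_mult_right Bochner_Integration.integrable_add
          integral_mult_right_zero 1 2 3)
  qed
  ultimately have "of_nat n * (\<integral>A. pow_trace k A * G A \<partial>\<mu>) + (- (of_nat n * (\<i> * s / 2 * of_nat k * \<xi> k))) * (\<integral>A. G A \<partial>\<mu>)
     = - (\<integral>A. loop_remainder I \<xi> s k A * G A \<partial>\<mu>)"
    by (simp only: eq_neg_iff_add_eq_0)
  then show ?thesis by (simp add: right_diff_distrib mult.assoc)
qed

lemma norm_product_le_squares: "norm (a :: complex) * norm (b :: complex) \<le> (norm a)\<^sup>2 + (norm b)\<^sup>2"
proof -
  have "0 \<le> (norm a - norm b)\<^sup>2 + (norm a)\<^sup>2 + (norm b)\<^sup>2" by simp
  then show ?thesis by (simp add: power2_diff)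
qed

text \<open>Each term has at most two traces. A product is at most a sum of squares and a single
  modulus at most 1 plus its square, so second moments suffice; \<open>s\<close> in the unit
  interval keeps the constant independent of \<open>s\<close>.\<close>

lemma loop_remainder_bounded:
  assumes I: "finite I" "\<And>j. j \<in> I \<Longrightarrow> j \<ge> 1"
  shows "\<exists>K::real. \<forall>n \<mu> s. n \<ge> 1 \<longrightarrow> unitary_haar n \<mu> \<longrightarrow> \<bar>s\<bar> \<le> 1 \<longrightarrow>
    (\<integral>A. norm (loop_remainder I \<xi> s k A) \<partial>\<mu>) \<le> K"
proof -
  have "\<forall>k. \<exists>C::real. k \<ge> 1 \<longrightarrow> (\<forall>n \<mu>. n \<ge> 1 \<longrightarrow> unitary_haar n \<mu> \<longrightarrow> (\<integral>A. (norm (pow_trace k A))\<^sup>2 \<partial>\<mu>) \<le> C)"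
    using pow_trace_second_moment_bounded by blast
  from choice[OF this] obtain C :: "nat \<Rightarrow> real" where
    C: "\<And>k n \<mu>. k \<ge> 1 \<Longrightarrow> n \<ge> 1 \<Longrightarrow> unitary_haar n \<mu> \<Longrightarrow> (\<integral>A. (norm (pow_trace k A))\<^sup>2 \<partial>\<mu>) \<le> C k"
    by blast
  \<comment> \<open>The distance of \<open>j\<close> and \<open>k\<close>, positive on
    \<open>I - {k}\<close>. All other exponents in \<open>K\<close> are positive too, so the second
    moment bounds \<open>C\<close> apply.\<close>
  define q where "q j = (if j \<le> k then k - j else j - k)" for j
  define K where "K = (\<Sum>m\<in>{1..<k}. C m + C (k - m)) + (\<Sum>j\<in>I. (j * norm (\<xi> j)) * (1 + C (k + j))) +
    (\<Sum>j\<in>I - {k}. (j * norm (\<xi> j)) * (1 + C (q j)))"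
  have "(\<integral>A. norm (loop_remainder I \<xi> s k A) \<partial>\<mu>) \<le> K"
    if n: "n \<ge> 1" and mu: "unitary_haar n \<mu>" and s: "\<bar>s\<bar> \<le> 1" for n \<mu> s
  proof -
    from mu interpret prob_space \<mu> by (simp add: unitary_haar_def)
    let ?p = "\<lambda>k A. (norm (pow_trace k A))\<^sup>2"
    define R where "R A = (\<Sum>m\<in>{1..<k}. ?p m A + ?p (k - m) A) + (\<Sum>j\<in>I. (j * norm (\<xi> j)) * (1 + ?p (k + j) A)) +
      (\<Sum>j\<in>I - {k}. (j * norm (\<xi> j)) * (1 + ?p (q j) A))" for A
    note int = pow_trace_square_integrable[OF mu]
    have le1: "norm (z :: complex) \<le> 1 + (norm z)\<^sup>2" for z
    proof -
      have "0 \<le> (norm z - 1 / 2)\<^sup>2 + 3 / 4" by (intro add_nonneg_nonneg) simp_all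
      then show ?thesis by (simp add: power2_diff power_divide)
    qed
    have c: "norm (c * complex_of_real s / 2 * (of_nat j * x * w)) \<le> (j * norm x) * (1 + (norm w)\<^sup>2)" if "norm c = 1" for j c x w
    proof -
      have "norm (c * complex_of_real s / 2 * (of_nat j * x * w)) = (\<bar>s\<bar> / 2) * ((j * norm x) * norm w)"
        using that by (simp add: norm_mult norm_divide)
      also have "\<dots> \<le> 1 * ((j * norm x) * (1 + (norm w)\<^sup>2))"
        using s by (intro mult_mono mult_left_mono le1) auto
      finally show ?thesis by simp
    qed
    have "norm (loop_remainder I \<xi> s k A) \<le> R A" for A
      unfolding loop_remainder_def R_def
    proof (intro norm_triangle_le add_mono order_trans[OF norm_sum] sum_mono)
      show "norm (pow_trace m A * pow_trace (k - m) A) \<le> ?p m A + ?p (k - m) A" for m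
        unfolding norm_mult by (rule norm_product_le_squares)
      show "norm (\<i> * s / 2 * (of_nat j * cnj (\<xi> j) * pow_trace (k + j) A)) \<le> (j * norm (\<xi> j)) * (1 + ?p (k + j) A)" for j
        using c[of \<i> j "cnj (\<xi> j)" "pow_trace (k + j) A"] by simp
      have "norm (adjoint_pow_trace k j A) = norm (pow_trace (q j) A)" for j
        by (simp add: adjoint_pow_trace_def q_def)
      then show "norm ((- \<i>) * s / 2 * (of_nat j * \<xi> j * adjoint_pow_trace k j A)) \<le> (j * norm (\<xi> j)) * (1 + ?p (q j) A)" for j
        using c[of "- \<i>" j "\<xi> j" "adjoint_pow_trace k j A"] by simp
    qed
    moreover have "integrable \<mu> R"
      unfolding R_def using int
      by (intro Bochner_Integration.integrable_add Bochner_Integration.integrable_sum integrable_mult_right integrable_const)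
    ultimately have "(\<integral>A. norm (loop_remainder I \<xi> s k A) \<partial>\<mu>) \<le> (\<integral>A. R A \<partial>\<mu>)"
      by (intro integral_mono integrable_norm bounded_measurable_integrable[OF mu] bounded_measurable_loop_remainder)
    also have "(\<integral>A. R A \<partial>\<mu>) = (\<Sum>m\<in>{1..<k}. (\<integral>A. ?p m A \<partial>\<mu>) + (\<integral>A. ?p (k - m) A \<partial>\<mu>)) +
        (\<Sum>j\<in>I. (j * norm (\<xi> j)) * (1 + (\<integral>A. ?p (k + j) A \<partial>\<mu>))) + (\<Sum>j\<in>I - {k}. (j * norm (\<xi> j)) * (1 + (\<integral>A. ?p (q j) A \<partial>\<mu>)))"
      unfolding R_def using int by (simp add: prob_space)
    also have "\<dots> \<le> K"
      unfolding K_def using n mu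
      by (intro add_mono sum_mono mult_left_mono C order_refl) (auto simp: q_def dest: I(2))
    finally show ?thesis .
  qed
  then show ?thesis by blast
qed

lemma integral_pow_trace_cis_approx:
  assumes I: "finite I" "\<And>j. j \<in> I \<Longrightarrow> j \<ge> 1" and k: "k \<in> I"
  shows "\<exists>K::real. \<forall>n \<mu> s. n \<ge> 1 \<longrightarrow> unitary_haar n \<mu> \<longrightarrow> \<bar>s\<bar> \<le> 1 \<longrightarrow>
    norm ((\<integral>A. pow_trace k A * cis (s * trace_form I \<xi> A) \<partial>\<mu>) -
       \<i> * s / 2 * of_nat k * \<xi> k * (\<integral>A. cis (s * trace_form I \<xi> A) \<partial>\<mu>)) \<le> K / n"
proof -
  obtain K where K: "\<And>n \<mu> s. n \<ge> 1 \<Longrightarrow> unitary_haar n \<mu> \<Longrightarrow> \<bar>s\<bar> \<le> 1 \<Longrightarrow>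
      (\<integral>A. norm (loop_remainder I \<xi> s k A) \<partial>\<mu>) \<le> K"
    using loop_remainder_bounded[OF I, of \<xi> k] by blast
  have "norm ((\<integral>A. pow_trace k A * cis (s * trace_form I \<xi> A) \<partial>\<mu>) -
       \<i> * s / 2 * of_nat k * \<xi> k * (\<integral>A. cis (s * trace_form I \<xi> A) \<partial>\<mu>)) \<le> K / n" (is "norm ?d \<le> _")
    if n: "n \<ge> 1" and mu: "unitary_haar n \<mu>" and s: "\<bar>s\<bar> \<le> 1" for n \<mu> s
  proof -
    have "n * norm ?d = norm (of_nat n * ?d)" by (simp add: norm_mult)
    also have "\<dots> = norm (\<integral>A. loop_remainder I \<xi> s k A * cis (s * trace_form I \<xi> A) \<partial>\<mu>)"
      by (simp only: characteristic_loop_equation[OF mu I(1) k I(2)[OF k]] norm_minus_cancel)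
    also have "\<dots> \<le> (\<integral>A. norm (loop_remainder I \<xi> s k A * cis (s * trace_form I \<xi> A)) \<partial>\<mu>)"
      by (rule integral_norm_bound)
    also have "\<dots> \<le> K" using K[OF n mu s] by (simp add: norm_mult)
    finally show ?thesis using n by (simp add: field_simps)
  qed
  then show ?thesis by blast
qed

text \<open>Along the ray of multiples of \<open>\<xi>\<close> the characteristic function solves
  the Gaussian equation up to an error of order \<open>1 / n\<close>. Multiplying by the integrating
  factor \<open>exp (s\<^sup>2 * \<sigma> / 4)\<close> leaves only that error, and the mean value
  inequality from 0 to 1 concludes.\<close>

lemma haar_characteristic_function_approx:
  assumes I: "finite I" "\<And>j. j \<in> I \<Longrightarrow> j \<ge> 1"
  shows "\<exists>K::real. \<forall>n \<mu>. n \<ge> 1 \<longrightarrow> unitary_haar n \<mu> \<longrightarrow>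
    norm ((\<integral>A. cis (trace_form I \<xi> A) \<partial>\<mu>) - complex_of_real (exp (- (\<Sum>j\<in>I. j * (norm (\<xi> j))\<^sup>2) / 4))) \<le> K / n"
proof -
  have "\<forall>k\<in>I. \<exists>K::real. \<forall>n \<mu> s. n \<ge> 1 \<longrightarrow> unitary_haar n \<mu> \<longrightarrow> \<bar>s\<bar> \<le> 1 \<longrightarrow>
    norm ((\<integral>A. pow_trace k A * cis (s * trace_form I \<xi> A) \<partial>\<mu>) -
       \<i> * s / 2 * of_nat k * \<xi> k * (\<integral>A. cis (s * trace_form I \<xi> A) \<partial>\<mu>)) \<le> K / n"
    using integral_pow_trace_cis_approx[OF I, where \<xi> = \<xi>] by blast
  from bchoice[OF this] obtain K :: "nat \<Rightarrow> real" where
    K: "\<And>k n \<mu> s. k \<in> I \<Longrightarrow> n \<ge> 1 \<Longrightarrow> unitary_haar n \<mu> \<Longrightarrow> \<bar>s\<bar> \<le> 1 \<Longrightarrow>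
    norm ((\<integral>A. pow_trace k A * cis (s * trace_form I \<xi> A) \<partial>\<mu>) -
       \<i> * s / 2 * of_nat k * \<xi> k * (\<integral>A. cis (s * trace_form I \<xi> A) \<partial>\<mu>)) \<le> K k / n"
    by blast
  define \<sigma> where "\<sigma> = (\<Sum>j\<in>I. j * (norm (\<xi> j))\<^sup>2)"
  define K0 where "K0 = (\<Sum>j\<in>I. norm (\<xi> j) * K j)"
  have s0: "\<sigma> \<ge> 0" by (simp add: \<sigma>_def sum_nonneg)
  have "norm ((\<integral>A. cis (trace_form I \<xi> A) \<partial>\<mu>) - complex_of_real (exp (- \<sigma> / 4))) \<le> (exp (\<sigma> / 4) * K0) / n"
    if n: "n \<ge> 1" and mu: "unitary_haar n \<mu>" for n \<mu>
  proof -
    from mu interpret prob_space \<mu> by (simp add: unitary_haar_def)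
    let ?L = "trace_form I \<xi>"
    define \<psi> where "\<psi> s = (\<integral>A. cis (s * ?L A) \<partial>\<mu>)" for s
    define a where "a j s = (\<integral>A. pow_trace j A * cis (s * ?L A) \<partial>\<mu>)" for j s
    define r where "r j s = a j s - \<i> * s / 2 * of_nat j * \<xi> j * \<psi> s" for j s
    \<comment> \<open>The derivative of the character in \<open>s\<close>, arranged so that
      conjugate traces appear as conjugates of a trace times the character at \<open>- s\<close>.
      Thus the estimate for \<open>a j\<close> covers both halves.\<close>
    define D where "D s A = (\<Sum>j\<in>I. \<i> / 2 * (cnj (\<xi> j) * (pow_trace j A * cis (s * ?L A)) +
        \<xi> j * cnj (pow_trace j A * cis (- s * ?L A))))" for s A
    have r: "norm (r j s) \<le> K j / n" if "j \<in> I" "\<bar>s\<bar> \<le> 1" for j s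
      using K[OF that(1) n mu that(2)] by (simp only: r_def a_def \<psi>_def)
    have ib: "integrable \<mu> (\<lambda>A. pow_trace j A * cis (s * ?L A))" for j s
      by (intro bounded_measurable_integrable[OF mu] bounded_measurable_mult bounded_measurable_pow_trace
          bounded_measurable_cis_trace_form)
    have D_eq: "D s A = \<i> * ?L A * cis (s * ?L A)" for s A
    proof -
      have "cnj z * (w * g) + z * cnj (w * cnj g) = 2 * complex_of_real (Re (cnj z * w)) * g" for z w g
        by (simp add: complex_eq_iff algebra_simps)
      from this[of _ _ "cis (s * ?L A)"]
      have "D s A = (\<Sum>j\<in>I. \<i> / 2 * (2 * complex_of_real (Re (cnj (\<xi> j) * pow_trace j A)) * cis (s * ?L A)))"
        unfolding D_def by (simp only: cis_cnj mult_minus_left)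
      also have "\<dots> = \<i> * (\<Sum>j\<in>I. complex_of_real (Re (cnj (\<xi> j) * pow_trace j A))) * cis (s * ?L A)"
        unfolding sum_distrib_left sum_distrib_right by (intro sum.cong refl) simp
      finally show ?thesis unfolding trace_form_def of_real_sum .
    qed
    have Dint: "(\<integral>A. D s A \<partial>\<mu>) = (\<Sum>j\<in>I. \<i> / 2 * (cnj (\<xi> j) * a j s + \<xi> j * cnj (a j (- s))))" for s
    proof -
      have "(\<integral>A. D s A \<partial>\<mu>) = (\<Sum>j\<in>I. \<integral>A. \<i> / 2 * (cnj (\<xi> j) * (pow_trace j A * cis (s * ?L A)) +
        \<xi> j * cnj (pow_trace j A * cis (- s * ?L A))) \<partial>\<mu>)"
        unfolding D_def
        by (intro Bochner_Integration.integral_sum integrable_mult_right Bochner_Integration.integrable_add integrable_cnj ib)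
      also have "\<dots> = (\<Sum>j\<in>I. \<i> / 2 * (cnj (\<xi> j) * a j s + \<xi> j * cnj (a j (- s))))"
        unfolding a_def
        by (simp only: integral_mult_right_zero Bochner_Integration.integral_add integrable_mult_right integrable_cnj ib Bochner_Integration.integral_cnj)
      finally show ?thesis .
    qed
    have psi_cnj: "cnj (\<psi> (- s)) = \<psi> s" for s
      unfolding \<psi>_def Bochner_Integration.integral_cnj[symmetric] by (simp add: cis_cnj)
    have ode: "norm ((\<integral>A. D s A \<partial>\<mu>) + (s * \<sigma> / 2) *\<^sub>R \<psi> s) \<le> K0 / n" if s: "\<bar>s\<bar> \<le> 1" for s
    proof -
      have a: "a j s = r j s + \<i> * s / 2 * of_nat j * \<xi> j * \<psi> s" for j s by (simp add: r_def)
      \<comment> \<open>The main parts of the two halves are equal, each contributing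
        \<open>- s / 4\<close> times \<open>j * (norm (\<xi> j))\<^sup>2 * \<psi> s\<close>; for the
        second half this uses \<open>psi_cnj\<close>.\<close>
      have "\<i> / 2 * (cnj (\<xi> j) * a j s + \<xi> j * cnj (a j (- s))) =
          \<i> / 2 * (cnj (\<xi> j) * r j s + \<xi> j * cnj (r j (- s))) - (s / 2 * (j * complex_of_real ((norm (\<xi> j))\<^sup>2))) * \<psi> s" for j
        unfolding a complex_norm_square by (simp add: psi_cnj field_simps)
      then have "(\<integral>A. D s A \<partial>\<mu>) = (\<Sum>j\<in>I. \<i> / 2 * (cnj (\<xi> j) * r j s + \<xi> j * cnj (r j (- s)))) -
          (s / 2 * complex_of_real \<sigma>) * \<psi> s"
        by (simp only: Dint sum_subtractf \<sigma>_def of_real_sum of_real_mult of_real_of_nat_eq flip: sum_distrib_left sum_distrib_right)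
      then have "(\<integral>A. D s A \<partial>\<mu>) + (s * \<sigma> / 2) *\<^sub>R \<psi> s = (\<Sum>j\<in>I. \<i> / 2 * (cnj (\<xi> j) * r j s + \<xi> j * cnj (r j (- s))))"
        by (simp add: scaleR_conv_of_real)
      also have "norm \<dots> \<le> (\<Sum>j\<in>I. norm (\<xi> j) * K j / n)"
      proof (intro order_trans[OF norm_sum] sum_mono)
        fix j assume j: "j \<in> I"
        have "norm (\<i> / 2 * (cnj (\<xi> j) * r j s + \<xi> j * cnj (r j (- s)))) \<le>
            (norm (\<xi> j) * norm (r j s) + norm (\<xi> j) * norm (r j (- s))) / 2"
          using norm_triangle_ineq[of "cnj (\<xi> j) * r j s" "\<xi> j * cnj (r j (- s))"] by (simp add: norm_mult norm_divide)
        also have "\<dots> \<le> (norm (\<xi> j) * (K j / n) + norm (\<xi> j) * (K j / n)) / 2"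
          using s by (intro divide_right_mono add_mono mult_left_mono r j) auto
        finally show "norm (\<i> / 2 * (cnj (\<xi> j) * r j s + \<xi> j * cnj (r j (- s)))) \<le> norm (\<xi> j) * K j / n"
          by (simp add: mult_ac)
      qed
      finally show ?thesis by (simp add: K0_def sum_divide_distrib)
    qed
    have dpsi: "(\<psi> has_vector_derivative (\<integral>A. D s A \<partial>\<mu>)) (at s)" for s
      unfolding \<psi>_def
    proof (rule has_vector_derivative_lebesgue_integral)
      show "finite_measure \<mu>" by (rule finite_measure_axioms)
      show "integrable \<mu> (\<lambda>A. cis (t * ?L A))" for t
        by (rule bounded_measurable_integrable[OF mu bounded_measurable_cis_trace_form])
      have "integrable \<mu> (D s)" unfolding D_def
        by (intro Bochner_Integration.integrable_sum integrable_mult_right Bochner_Integration.integrable_add integrable_cnj ib)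
      then show "D s \<in> borel_measurable \<mu>" by (rule borel_measurable_integrable)
      show "((\<lambda>s. cis (s * ?L A)) has_vector_derivative D t A) (at t)" for t A
      proof -
        have "((\<lambda>z. exp (\<i> * z * ?L A)) has_field_derivative (\<i> * ?L A) * exp (\<i> * t * ?L A)) (at (complex_of_real t))"
          by (auto intro!: derivative_eq_intros)
        from has_vector_derivative_real_field[OF this] show ?thesis
          unfolding D_eq cis_conv_exp by (simp add: mult.assoc)
      qed
      \<comment> \<open>This bound grows with \<open>n\<close>, which is harmless: it only justifies
        differentiating under the integral for fixed \<open>n\<close> and does not enter the
        rate.\<close>
      show "norm (D t A) \<le> (\<Sum>j\<in>I. norm (\<xi> j) * n)" if "A \<in> space \<mu>" for t A
      proof -
        have A: "A \<in> unitary_group n" using that space_unitary_haar[OF mu] by simp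
        have "norm (D t A) = \<bar>?L A\<bar>" by (simp add: D_eq norm_mult)
        also have "\<dots> \<le> (\<Sum>j\<in>I. norm (\<xi> j) * n)"
          unfolding trace_form_def
        proof (intro order_trans[OF sum_abs] sum_mono)
          fix j
          have "\<bar>Re (cnj (\<xi> j) * pow_trace j A)\<bar> \<le> norm (\<xi> j) * norm (pow_trace j A)"
            using abs_Re_le_cmod[of "cnj (\<xi> j) * pow_trace j A"] by (simp only: norm_mult complex_mod_cnj)
          also have "\<dots> \<le> norm (\<xi> j) * n" by (intro mult_left_mono norm_pow_trace_le[OF A]) simp
          finally show "\<bar>Re (cnj (\<xi> j) * pow_trace j A)\<bar> \<le> norm (\<xi> j) * n" .
        qed
        finally show ?thesis .
      qed
    qed
    define \<Psi> where "\<Psi> s = exp (s\<^sup>2 * \<sigma> / 4) *\<^sub>R \<psi> s" for s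
    have dchi: "(\<Psi> has_vector_derivative exp (s\<^sup>2 * \<sigma> / 4) *\<^sub>R ((\<integral>A. D s A \<partial>\<mu>) + (s * \<sigma> / 2) *\<^sub>R \<psi> s)) (at s)" for s
    proof -
      have "((\<lambda>s. exp (s\<^sup>2 * \<sigma> / 4)) has_real_derivative exp (s\<^sup>2 * \<sigma> / 4) * (s * \<sigma> / 2)) (at s)"
        by (auto intro!: derivative_eq_intros)
      from has_vector_derivative_scaleR[OF this dpsi] show ?thesis
        unfolding \<Psi>_def by (simp add: scaleR_add_right)
    qed
    have "norm (\<Psi> 1 - \<Psi> 0) \<le> (exp (\<sigma> / 4) * (K0 / n)) * norm (1 - 0 :: real)"
    proof (rule differentiable_bound[where S = "{0..1}"])
      fix s :: real assume s: "s \<in> {0..1}"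
      let ?d = "exp (s\<^sup>2 * \<sigma> / 4) *\<^sub>R ((\<integral>A. D s A \<partial>\<mu>) + (s * \<sigma> / 2) *\<^sub>R \<psi> s)"
      show "(\<Psi> has_derivative (\<lambda>h. h *\<^sub>R ?d)) (at s within {0..1})"
        using has_vector_derivative_at_within[OF dchi] by (simp only: has_vector_derivative_def)
      have "s\<^sup>2 * \<sigma> / 4 \<le> \<sigma> / 4"
        using s s0 by (intro divide_right_mono mult_left_le_one_le) (auto simp: power_le_one)
      then have "norm ?d \<le> exp (\<sigma> / 4) * (K0 / n)"
        using ode[of s] s unfolding norm_scaleR by (intro mult_mono) auto
      then show "onorm (\<lambda>h. h *\<^sub>R ?d) \<le> exp (\<sigma> / 4) * (K0 / n)"
        by (intro onorm_le) (simp only: norm_scaleR real_norm_def mult.commute mult_left_mono abs_ge_zero)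
    qed auto
    \<comment> \<open>The initial value is \<open>\<Psi> 0 = 1\<close>, and undoing the integrating
      factor at 1 only shrinks the error.\<close>
    moreover have "\<psi> 1 - complex_of_real (exp (- \<sigma> / 4)) = exp (- \<sigma> / 4) *\<^sub>R (\<Psi> 1 - \<Psi> 0)"
      by (simp add: \<Psi>_def \<psi>_def prob_space scaleR_conv_of_real exp_minus field_simps)
    moreover have "exp (- \<sigma> / 4) * norm (\<Psi> 1 - \<Psi> 0) \<le> 1 * norm (\<Psi> 1 - \<Psi> 0)"
      using s0 by (intro mult_right_mono) auto
    ultimately show ?thesis by (simp add: \<psi>_def)
  qed
  then show ?thesis unfolding \<sigma>_def by blast
qed

section \<open>Convergence of the vector of traces to independent Gaussians\<close>

theorem theorem5p1:
  fixes M :: "nat \<Rightarrow> 'a measure"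
    and U :: "nat \<Rightarrow> 'a \<Rightarrow> complex mat"
    and l :: nat
  assumes "\<And>n. n \<ge> 1 \<Longrightarrow> haar_unitary_random_matrix n (M n) (U n)"
    and "l \<ge> 1"
  shows "\<exists>(N :: (nat \<Rightarrow> complex) measure) (Z :: nat \<Rightarrow> (nat \<Rightarrow> complex) \<Rightarrow> complex).
    prob_space N \<and>
    prob_space.indep_vars N (\<lambda>_. borel) Z {1..l} \<and>
    converges_in_distribution {1..l} M
      (\<lambda>n \<omega>. \<lambda>i\<in>{1..l}. mat_trace (U n \<omega> ^\<^sub>m i))
      N (\<lambda>\<omega>. \<lambda>i\<in>{1..l}. Z i \<omega>)"
proof -
  let ?I = "{1..l}"
  \<comment> \<open>The estimates concern Haar measure alone and are transferred to
    \<open>M n\<close> through the law of \<open>U n\<close>. They are available from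
    \<open>n = 1\<close> on, so limits are taken along eventual indices.\<close>
  define \<mu> where "\<mu> n = distr (M n) (unitary_borel n) (U n)" for n
  have M: "prob_space (M n)" and U: "U n \<in> measurable (M n) (unitary_borel n)" and mu: "unitary_haar n (\<mu> n)"
    if "n \<ge> 1" for n
    using assms(1)[OF that] by (auto simp: haar_unitary_random_matrix_def \<mu>_def)
  have push_meas: "(\<lambda>\<omega>. F (U n \<omega>)) \<in> borel_measurable (M n)" if "n \<ge> 1" "bounded_measurable n F" for n F
    using measurable_compose[OF U[OF that(1)], of F borel] that(2) by (simp add: bounded_measurable_def)
  have push_int: "(\<integral>\<omega>. F (U n \<omega>) \<partial>M n) = (\<integral>A. F A \<partial>\<mu> n)"
    if "n \<ge> 1" "F \<in> borel_measurable (unitary_borel n)" for n and F :: "complex mat \<Rightarrow> 'c::{banach, second_countable_topology}"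
    unfolding \<mu>_def using integral_distr[OF U[OF that(1)] that(2)] by simp
  have "pow_trace i \<in> borel_measurable (unitary_borel n)" for i n
    using bounded_measurable_pow_trace[of n i] by (simp add: bounded_measurable_def)
  then have p_meas: "(\<lambda>A. (norm (pow_trace i A))\<^sup>2) \<in> borel_measurable (unitary_borel n)" for i n
    by simp
  have "\<forall>i\<in>?I. \<exists>C::real. \<forall>n \<mu>. n \<ge> 1 \<longrightarrow> unitary_haar n \<mu> \<longrightarrow> (\<integral>A. (norm (pow_trace i A))\<^sup>2 \<partial>\<mu>) \<le> C"
    using pow_trace_second_moment_bounded by simp
  from bchoice[OF this] obtain C :: "nat \<Rightarrow> real" where
    C: "\<And>i n \<mu>. i \<in> ?I \<Longrightarrow> n \<ge> 1 \<Longrightarrow> unitary_haar n \<mu> \<Longrightarrow> (\<integral>A. (norm (pow_trace i A))\<^sup>2 \<partial>\<mu>) \<le> C i"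
    by blast
  have "converges_in_distribution ?I M (\<lambda>n \<omega>. \<lambda>i\<in>?I. mat_trace (U n \<omega> ^\<^sub>m i))
      (gaussian_vector ?I) (\<lambda>\<omega>. \<lambda>i\<in>?I. \<omega> i)"
  \<comment> \<open>The second moment bounds depend on the component; their maximum over the finite
    index set is a common one.\<close>
  proof (rule converges_in_distribution_of_characteristic_functions[OF _ M, where C = "Max (C ` ?I)"])
    fix n i :: nat assume n: "n \<ge> 1" and i: "i \<in> ?I"
    show "(\<lambda>\<omega>. (\<lambda>i\<in>?I. mat_trace (U n \<omega> ^\<^sub>m i)) i) \<in> borel_measurable (M n)"
      using push_meas[OF n bounded_measurable_pow_trace[of n i]] i by (simp add: pow_trace_def)
    show "integrable (M n) (\<lambda>\<omega>. (norm ((\<lambda>i\<in>?I. mat_trace (U n \<omega> ^\<^sub>m i)) i))\<^sup>2)"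
      using pow_trace_square_integrable[OF mu[OF n], of i] i
      unfolding \<mu>_def integrable_distr_eq[OF U[OF n] p_meas] by (simp add: pow_trace_def)
    have "(\<integral>\<omega>. (norm ((\<lambda>i\<in>?I. mat_trace (U n \<omega> ^\<^sub>m i)) i))\<^sup>2 \<partial>M n) = (\<integral>A. (norm (pow_trace i A))\<^sup>2 \<partial>\<mu> n)"
      using push_int[OF n p_meas, of i] i by (simp add: pow_trace_def)
    also have "\<dots> \<le> C i" by (rule C[OF i n mu[OF n]])
    also have "\<dots> \<le> Max (C ` ?I)" using i by (intro Max_ge) auto
    finally show "(\<integral>\<omega>. (norm ((\<lambda>i\<in>?I. mat_trace (U n \<omega> ^\<^sub>m i)) i))\<^sup>2 \<partial>M n) \<le> Max (C ` ?I)" .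
  next
    fix i assume i: "i \<in> ?I"
    show "(\<lambda>\<omega>. (\<lambda>i\<in>?I. \<omega> i) i) \<in> borel_measurable (gaussian_vector ?I)"
      using gaussian_vector_component_measurable[OF i] i by simp
    show "integrable (gaussian_vector ?I) (\<lambda>\<omega>. (norm ((\<lambda>i\<in>?I. \<omega> i) i))\<^sup>2)"
      using gaussian_vector_second_moment[OF i] i by simp
  next
    fix \<xi> :: "nat \<Rightarrow> complex"
    have restr: "(\<Sum>j\<in>?I. Re (cnj (\<xi> j) * (\<lambda>i\<in>?I. w i) j)) = (\<Sum>j\<in>?I. Re (cnj (\<xi> j) * w j))" for w
      by (intro sum.cong refl) simp
    have Z: "(\<integral>\<omega>. cis (\<Sum>j\<in>?I. Re (cnj (\<xi> j) * (\<lambda>i\<in>?I. \<omega> i) j)) \<partial>gaussian_vector ?I) =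
        complex_of_real (exp (- (\<Sum>j\<in>?I. j * (norm (\<xi> j))\<^sup>2) / 4))" (is "_ = ?z")
      unfolding restr by (rule gaussian_vector_char) simp
    have X: "(\<integral>\<omega>. cis (\<Sum>j\<in>?I. Re (cnj (\<xi> j) * (\<lambda>i\<in>?I. mat_trace (U n \<omega> ^\<^sub>m i)) j)) \<partial>M n) =
        (\<integral>A. cis (trace_form ?I \<xi> A) \<partial>\<mu> n)" if "n \<ge> 1" for n
    proof -
      have "(\<lambda>A. cis (trace_form ?I \<xi> A)) \<in> borel_measurable (unitary_borel n)"
        using bounded_measurable_cis_trace_form[of n 1 ?I \<xi>] by (simp add: bounded_measurable_def)
      from push_int[OF that this] show ?thesis by (simp only: restr trace_form_def pow_trace_def)
    qed
    obtain K :: real where K: "\<And>n \<mu>. n \<ge> 1 \<Longrightarrow> unitary_haar n \<mu> \<Longrightarrow>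
        norm ((\<integral>A. cis (trace_form ?I \<xi> A) \<partial>\<mu>) - ?z) \<le> K / n"
      using haar_characteristic_function_approx[of ?I \<xi>] by auto
    have "(\<lambda>n. (\<integral>\<omega>. cis (\<Sum>j\<in>?I. Re (cnj (\<xi> j) * (\<lambda>i\<in>?I. mat_trace (U n \<omega> ^\<^sub>m i)) j)) \<partial>M n) - ?z) \<longlonglongrightarrow> 0"
    proof (rule Lim_null_comparison)
      show "\<forall>\<^sub>F n in sequentially. norm ((\<integral>\<omega>. cis (\<Sum>j\<in>?I. Re (cnj (\<xi> j) * (\<lambda>i\<in>?I. mat_trace (U n \<omega> ^\<^sub>m i)) j)) \<partial>M n) - ?z) \<le> K / n"
        using eventually_ge_at_top[of 1]
        by eventually_elim (simp only: X K mu)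
      show "(\<lambda>n. K / real n) \<longlonglongrightarrow> 0" by (rule lim_const_over_n)
    qed
    then show "(\<lambda>n. \<integral>\<omega>. cis (\<Sum>j\<in>?I. Re (cnj (\<xi> j) * (\<lambda>i\<in>?I. mat_trace (U n \<omega> ^\<^sub>m i)) j)) \<partial>M n)
       \<longlonglongrightarrow> (\<integral>\<omega>. cis (\<Sum>j\<in>?I. Re (cnj (\<xi> j) * (\<lambda>i\<in>?I. \<omega> i) j)) \<partial>gaussian_vector ?I)"
      unfolding Z by (simp only: LIM_zero_iff)
  qed (auto intro: prob_space_gaussian_vector)
  \<comment> \<open>Here \<open>l \<ge> 1\<close> enters, for \<open>gaussian_vector_indep\<close>;
    the witnesses are \<open>gaussian_vector\<close> and its coordinate projections.\<close>
  moreover have "?I \<noteq> {}" using assms(2) by auto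
  ultimately show ?thesis
    using prob_space_gaussian_vector[of ?I] gaussian_vector_indep[of ?I] by blast
qed

end
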